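(* Let $0<q<1$ and $1<p<q+1$. Suppose that there exists $c>0$ such that $$\delta_{k+1}\le\frac{k^p}{(1+c)k^p-c(k+1)^p}\,\delta_k\quad\text{for all } k\ge 1,$$ and that there exists $c_0>0$ such that $\delta_k^2\ge c_0k^{p-q}$ for all $k\ge1$. Then, for any sequence $(x_k)_{k\in\mathbb N}$ generated by the algorithm (IPGA) described in the context, with $\bar x_k$ and $\bar x^*$ as defined in the context, we have $\lim_{k\to+\infty}x_k=\bar x^*$ (strongly), and the following hold. (i) If $1<p<2q$, then as $k\to+\infty$, $$g(x_k)-g(\bar x^* )=\mathcal O\left(\frac{1}{k^p\delta_k}\right),\quad \|x_k-\bar x_k\|=\mathcal O\left(\frac{1}{k^{\frac{1-q}{2}}}\right),\quad \|\nabla g(x_k)\|=\mathcal O\left(\frac{1}{k^{\frac{p-q+1}{2}}\delta_k}\right),\quad \|x_k-x_{k-1}\|=\mathcal O\left(\frac{1}{k^{\frac{p-q+1}{2}}}\right).$$ (ii) If $2q\le p<\frac12(3q+1)$, then as $k\to+\infty$, $$g(x_k)-g(\bar x^* )=\mathcal O\left(\frac{1}{k^p\delta_k}\right),\quad \|x_k-\bar x_k\|=\mathcal O\left(\frac{1}{k^{\frac{1-q}{2}}}\right),\quad \|\nabla g(x_k)\|=\mathcal O\left(\frac{1}{k^{\frac{q+1}{2}}\delta_k}\right),\quad \|x_k-x_{k-1}\|=\mathcal O\left(\frac{1}{k^{\frac{q+1}{2}}}\right).$$ (iii) If $\frac12(3q+1)\le p<q+1$, then as $k\to+\infty$, $$\|x_k-\bar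 x_k\|=\mathcal O\left(\frac{1}{k^{q-p+1}}\right),\quad \|\nabla g(x_k)\|=\mathcal O\left(\frac{1}{k^{2q-p+1}\delta_k}\right),\quad \|x_k-x_{k-1}\|=\mathcal O\left(\frac{1}{k^{2q-p+1}}\right).$$ Further, if $\frac12(3q+1)\le p<\frac13(4q+2)$, then $g(x_k)-g(\bar x^* )=\mathcal O\left(\frac{1}{k^p\delta_k}\right)$ as $k\to+\infty$, and if $\frac13(4q+2)\le p<q+1$, then $g(x_k)-g(\bar x^* )=\mathcal O\left(\frac{1}{k^{4q-2p+2}\delta_k}\right)$ as $k\to+\infty$.
   Context: $\mathcal X$ is a real Hilbert space with norm $\|\cdot\|$, and $g:\mathcal X\to\mathbb R$ is a differentiable convex function whose set of minimizers $\operatorname{argmin} g$ is nonempty. For $\rho>0$, $\mathrm{prox}_{\rho g}(y)=\operatorname{argmin}_{x\in\mathcal X}\{g(x)+\frac{1}{2\rho}\|x-y\|^2\}$, equivalently $\mathrm{prox}_{\rho g}=(I+\rho\nabla g)^{-1}$. Algorithm (IPGA): the parameters are $\alpha,a,\beta,h,q,p>0$ with $0<q<1$, and $\{\delta_k\}_{k\in\mathbb N}$ is a non-decreasing sequence of positive real numbers with $\lim_{k\to+\infty}\delta_k=+\infty$. Given arbitrary $x_0,x_1\in\mathcal X$, for $k=1,2,\dots$ set $$d_k=\frac{(kh)^{q+p}}{(kh)^{q+p}+\alpha h(kh)^p+ah^2(kh)^q},\qquad y_k=x_k+d_k\left(x_k-x_{k-1}+\beta h\nabla g(x_k)\right),$$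 $$\rho_k=d_k(\beta h+h^2\delta_k),\qquad a_k=a(kh)^{-p},\qquad x_{k+1}=\mathrm{prox}_{\rho_k g}\left(y_k-h^2d_ka_kx_k\right).$$ For $k\ge1$, $\bar x_k$ denotes the unique minimizer over $\mathcal X$ of the strongly convex function $g_k(x):=g(x)+\frac{a_k}{2\delta_k}\|x\|^2$. The point $\bar x^*$ is the minimal norm element of $\operatorname{argmin} g$. *)

theory Defs
  imports "HOL-Analysis.Analysis" "HOL-Library.Landau_Symbols"
begin

definition argmin :: "('a \<Rightarrow> real) \<Rightarrow> 'a set" where
  "argmin f = {z. is_arg_min f (\<lambda>_. True) z}"

(* ARG_MIN selects some minimizer. In prox and tikhonov_point the objective is
   strongly convex and continuous on a Hilbert space, and in min_norm_element one
   projects 0 onto a nonempty closed convex set; so in all three uses the minimizer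
   exists and is unique, and the selection is the minimizer. *)

definition prox :: "real \<Rightarrow> ('a::real_inner \<Rightarrow> real) \<Rightarrow> 'a \<Rightarrow> 'a" where
  "prox \<rho> g y = (ARG_MIN (\<lambda>x. g x + 1 / (2 * \<rho>) * (norm (x - y))\<^sup>2) x. True)"

definition min_norm_element :: "'a::real_inner set \<Rightarrow> 'a" where
  "min_norm_element S = (ARG_MIN norm x. x \<in> S)"

definition ipga_d :: "real \<Rightarrow> real \<Rightarrow> real \<Rightarrow> real \<Rightarrow> real \<Rightarrow> nat \<Rightarrow> real" where
  "ipga_d \<alpha> a h q p k =
     (real k * h) powr (q + p) /
     ((real k * h) powr (q + p) + \<alpha> * h * (real k * h) powr p + a * h\<^sup>2 * (real k * h) powr q)"

definition ipga_a :: "real \<Rightarrow> real \<Rightarrow> real \<Rightarrow> nat \<Rightarrow> real" where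
  "ipga_a a h p k = a * (real k * h) powr (- p)"

definition ipga_rho ::
    "real \<Rightarrow> real \<Rightarrow> real \<Rightarrow> real \<Rightarrow> real \<Rightarrow> real \<Rightarrow> (nat \<Rightarrow> real) \<Rightarrow> nat \<Rightarrow> real" where
  "ipga_rho \<alpha> a \<beta> h q p \<delta> k = ipga_d \<alpha> a h q p k * (\<beta> * h + h\<^sup>2 * \<delta> k)"

(* gradg is the gradient of g. *)
definition ipga_y ::
    "real \<Rightarrow> real \<Rightarrow> real \<Rightarrow> real \<Rightarrow> real \<Rightarrow> real \<Rightarrow> ('a::real_inner \<Rightarrow> 'a) \<Rightarrow> (nat \<Rightarrow> 'a) \<Rightarrow> nat \<Rightarrow> 'a" where
  "ipga_y \<alpha> a \<beta> h q p gradg x k =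
     x k + ipga_d \<alpha> a h q p k *\<^sub>R (x k - x (k - 1) + (\<beta> * h) *\<^sub>R gradg (x k))"

(* x 0 and x 1 are arbitrary. *)
definition ipga_sequence ::
    "real \<Rightarrow> real \<Rightarrow> real \<Rightarrow> real \<Rightarrow> real \<Rightarrow> real \<Rightarrow> (nat \<Rightarrow> real) \<Rightarrow>
     ('a::real_inner \<Rightarrow> real) \<Rightarrow> ('a \<Rightarrow> 'a) \<Rightarrow> (nat \<Rightarrow> 'a) \<Rightarrow> bool" where
  "ipga_sequence \<alpha> a \<beta> h q p \<delta> g gradg x \<longleftrightarrow>
     (\<forall>k\<ge>1. x (k + 1) =
        prox (ipga_rho \<alpha> a \<beta> h q p \<delta> k) g
          (ipga_y \<alpha> a \<beta> h q p gradg x k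
             - (h\<^sup>2 * ipga_d \<alpha> a h q p k * ipga_a a h p k) *\<^sub>R x k))"

definition tikhonov_point ::
    "real \<Rightarrow> real \<Rightarrow> real \<Rightarrow> (nat \<Rightarrow> real) \<Rightarrow> ('a::real_inner \<Rightarrow> real) \<Rightarrow> nat \<Rightarrow> 'a" where
  "tikhonov_point a h p \<delta> g k =
     (ARG_MIN (\<lambda>x. g x + ipga_a a h p k / (2 * \<delta> k) * (norm x)\<^sup>2) x. True)"

end

theory Submission
  imports Defs
begin

text \<open>
  Dividing the proximal step by \<open>d\<^sub>k\<close> turns the iteration into an implicit discretisation of a
  damped inertial system: with \<open>u\<^sub>k = x\<^sub>k - x\<^bsub>k-1\<^esub> + \<beta> h \<nabla>g(x\<^sub>k)\<close>,
  the increment of \<open>u\<close> is minus the damping \<open>A k\<^bsup>-q\<^esup> (x\<^bsub>k+1\<^esub> - x\<^sub>k)\<close> minus the gradient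
  at \<open>x\<^bsub>k+1\<^esub>\<close> of \<open>\<phi>\<^sub>k = h\<^sup>2 (\<delta>\<^sub>k g + a\<^sub>k/2 \<parallel>\<cdot>\<parallel>\<^sup>2)\<close>, whose
  minimiser is \<open>z\<^sub>k\<close>, the Tikhonov point.
  With \<open>\<lambda>\<^sub>k = A k\<^bsup>-q\<^esup>/2\<close> the energy
  \<open>\<parallel>\<lambda>\<^sub>k (x\<^sub>k - z\<^sub>k) + u\<^sub>k\<parallel>\<^sup>2/2 + \<phi>\<^sub>k(x\<^sub>k) - \<phi>\<^sub>k(z\<^sub>k)
    + \<lambda>\<^sub>k\<^sup>2 \<parallel>x\<^sub>k - z\<^sub>k\<parallel>\<^sup>2/2\<close>
  contracts along one step with frozen coefficients by a factor \<open>1 - c k\<^bsup>-s\<^esup>\<close>,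
  \<open>s = max q (p - q)\<close>; the strong convexity of \<open>\<phi>\<^sub>k\<close> and the dissipation of \<open>\<nabla>g\<close> pay for it.
  Updating the coefficients afterwards costs a forcing of order
  \<open>k\<^bsup>-(p+1)\<^esup> + k\<^bsup>-(2q+2-s)\<^esup>\<close>, because the Tikhonov points move by
  \<open>O(1/k)\<close>. A discrete Gronwall argument then bounds the energy, from which every rate is read off.
\<close>

section \<open>Convexity and proximal points\<close>

lemma GDERIV_norm_diff_sq:
  "GDERIV (\<lambda>x. c * (norm (x - y))\<^sup>2) z :> (2 * c) *\<^sub>R (z - y)"
  unfolding gderiv_def power2_norm_eq_inner
  by (auto intro!: derivative_eq_intros simp: inner_commute algebra_simps)

text \<open>For \<open>0 < t < 1\<close> convexity bounds the difference quotient of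
  \<open>f\<close> along the segment from \<open>z\<close> to \<open>y\<close> by
  \<open>f y - f z\<close>; its limit at \<open>0\<close> from the right is
  \<open>inner d (y - z)\<close>.\<close>

lemma convex_GDERIV_ge:
  assumes cvx: "convex_on UNIV f" and der: "GDERIV f z :> d"
  shows "f y \<ge> f z + inner d (y - z)"
proof -
  let ?h = "\<lambda>t. f (z + t *\<^sub>R (y - z))"
  have "(?h has_derivative (\<lambda>t. inner (t *\<^sub>R (y - z)) d)) (at 0)"
  proof -
    have "(f has_derivative (\<lambda>h. inner h d)) (at (z + 0 *\<^sub>R (y - z)))"
      using der by (simp add: gderiv_def)
    then show ?thesis
      by (rule has_derivative_compose[rotated]) (auto intro!: derivative_eq_intros)
  qed
  then have "(?h has_field_derivative inner (y - z) d) (at 0)"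
    by (simp add: has_field_derivative_def mult.commute[of _ "inner (y - z) d"])
  then have "((\<lambda>t. (?h t - f z) / t) \<longlongrightarrow> inner (y - z) d) (at 0)"
    by (simp add: has_field_derivative_iff)
  then have lim: "((\<lambda>t. (?h t - f z) / t) \<longlongrightarrow> inner (y - z) d) (at_right 0)"
    using filterlim_at_split by blast
  have "eventually (\<lambda>t::real. (?h t - f z) / t \<le> f y - f z) (at_right 0)"
  proof -
    have "eventually (\<lambda>t::real. t \<in> {0<..<1}) (at_right 0)"
      by (rule eventually_at_right_real) simp
    then show ?thesis
    proof eventually_elim
      case (elim t)
      have "f ((1 - t) *\<^sub>R z + t *\<^sub>R y) \<le> (1 - t) * f z + t * f y"
        using convex_onD[OF cvx, of t z y] elim by simp
      then show ?case using elim by (simp add: field_simps scaleR_diff_right scaleR_diff_left)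
    qed
  qed
  from tendsto_upperbound[OF lim this] show ?thesis by (simp add: inner_commute)
qed

lemma GDERIV_zero_at_min:
  assumes der: "GDERIV f z :> d" and min: "\<And>y. f z \<le> f y"
  shows "d = 0"
proof -
  have "(\<lambda>h. inner h d) = (\<lambda>h. 0)"
    by (rule has_derivative_local_min[of f]) (use assms in \<open>auto simp: gderiv_def\<close>)
  then have "inner d d = 0" by (rule fun_cong)
  then show ?thesis by simp
qed

text \<open>The parallelogram identity with its exact defect, which turns near-minimality of two
  points into closeness.\<close>

lemma norm_sq_midpoint:
  fixes u v y :: "'a::real_inner"
  shows "(norm ((1/2) *\<^sub>R u + (1/2) *\<^sub>R v - y))\<^sup>2 =
    (norm (u - y))\<^sup>2 / 2 + (norm (v - y))\<^sup>2 / 2 - (norm (u - v))\<^sup>2 / 4"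
  unfolding power2_norm_eq_inner
  by (simp add: inner_simps inner_commute field_simps)

text \<open>Minimising sequences are Cauchy by strong convexity, which replaces weak compactness.\<close>

lemma strongly_convex_has_min:
  fixes f :: "'a::{real_inner, complete_space} \<Rightarrow> real"
  assumes cvx: "convex_on UNIV f" and cont: "continuous_on UNIV f"
    and bdd: "\<And>x. m \<le> f x" and c: "c > 0"
  shows "\<exists>z. \<forall>x. f z + c * (norm (z - y))\<^sup>2 \<le> f x + c * (norm (x - y))\<^sup>2"
proof -
  define F where "F x = f x + c * (norm (x - y))\<^sup>2" for x
  define I where "I = Inf (range F)"
  have bb: "bdd_below (range F)"
    by (rule bdd_belowI[of _ m]) (use bdd c in \<open>auto simp: F_def add_increasing2\<close>)
  have I_le: "I \<le> F x" for x unfolding I_def by (rule cInf_lower) (auto simp: bb)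
  have "\<exists>x. F x < I + 1 / real (Suc n)" for n
    using cInf_lessD[of "range F" "I + 1 / real (Suc n)"] unfolding I_def by auto
  then obtain s where s: "\<And>n. F (s n) < I + 1 / real (Suc n)" by metis
  \<comment> \<open>Both points are compared with their midpoint, whose value is at least the
    infimum \<open>I\<close>, so near-minimal points must be close.\<close>
  have gap: "c / 4 * (norm (u - v))\<^sup>2 \<le> F u / 2 + F v / 2 - I" for u v
  proof -
    have "f ((1/2) *\<^sub>R u + (1/2) *\<^sub>R v) \<le> f u / 2 + f v / 2"
      using convex_onD[OF cvx, of "1/2" u v] by simp
    then have "F ((1/2) *\<^sub>R u + (1/2) *\<^sub>R v) \<le> F u / 2 + F v / 2 - c / 4 * (norm (u - v))\<^sup>2"
      unfolding F_def norm_sq_midpoint by (simp add: field_simps)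
    with I_le[of "(1/2) *\<^sub>R u + (1/2) *\<^sub>R v"] show ?thesis by linarith
  qed
  have "Cauchy s"
  proof (rule metric_CauchyI)
    fix e :: real assume e: "e > 0"
    then have "0 < c / 4 * e\<^sup>2" using c by simp
    then obtain N where N: "1 / real (Suc N) < c / 4 * e\<^sup>2"
      using reals_Archimedean by (metis inverse_eq_divide)
    have "dist (s m) (s n) < e" if "m \<ge> N" "n \<ge> N" for m n
    proof -
      have "1 / real (Suc m) \<le> 1 / real (Suc N)" "1 / real (Suc n) \<le> 1 / real (Suc N)"
        using that by (auto simp: frac_le)
      then have "c / 4 * (norm (s m - s n))\<^sup>2 < c / 4 * e\<^sup>2"
        using gap[of "s m" "s n"] s[of m] s[of n] N by linarith
      then show ?thesis using c e by (simp add: dist_norm power2_less_imp_less)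
    qed
    then show "\<exists>M. \<forall>m\<ge>M. \<forall>n\<ge>M. dist (s m) (s n) < e" by blast
  qed
  then obtain z where z: "s \<longlonglongrightarrow> z" by (auto simp: Cauchy_convergent_iff convergent_def)
  have "continuous_on UNIV F" unfolding F_def by (intro continuous_intros cont)
  then have "(\<lambda>n. F (s n)) \<longlonglongrightarrow> F z"
    using z by (simp add: continuous_on_eq_continuous_at isCont_tendsto_compose)
  moreover have "(\<lambda>n. I + 1 / real (Suc n)) \<longlonglongrightarrow> I + 0"
    by (intro tendsto_intros) (rule LIMSEQ_Suc[OF lim_1_over_n])
  ultimately have "F z \<le> I + 0"
    by (rule LIMSEQ_le) (use s less_imp_le in blast)
  then have "F z \<le> F x" for x using I_le[of x] by simp
  then show ?thesis unfolding F_def by blast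
qed

section \<open>Stationarity of the minimisers selected by \<open>ARG_MIN\<close>\<close>

lemma ARG_MIN_UNIV_le:
  assumes "\<exists>z. \<forall>x. f z \<le> (f x :: real)"
  shows "f (ARG_MIN f x. True) \<le> f y"
proof -
  have "\<exists>z. is_arg_min f (\<lambda>_. True) z" using assms by (auto simp: is_arg_min_linorder)
  then have "is_arg_min f (\<lambda>_. True) (ARG_MIN f x. True)" unfolding arg_min_def by (rule someI_ex)
  then show ?thesis by (auto simp: is_arg_min_linorder)
qed

context
  fixes g :: "'a::{real_inner, complete_space} \<Rightarrow> real" and gradg :: "'a \<Rightarrow> 'a" and m :: real
  assumes cvx: "convex_on UNIV g" and grad: "\<And>z. GDERIV g z :> gradg z"
    and bdd: "\<And>z. m \<le> g z"
begin

lemma gradient_continuous_on: "continuous_on UNIV g"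
  by (rule has_derivative_continuous_on[of UNIV g "\<lambda>z h. inner h (gradg z)"])
     (use grad in \<open>simp add: gderiv_def\<close>)

text \<open>Fermat's rule at the minimiser, which exists by strong convexity. Free \<open>c\<close>
  and \<open>y\<close> cover both the proximal map, with \<open>c = 1 / (2 * \<rho>)\<close>, and
  the Tikhonov points, with \<open>y = 0\<close>.\<close>

lemma ARG_MIN_stationary:
  fixes y
  assumes "c > 0"
  defines "z \<equiv> ARG_MIN (\<lambda>x. g x + c * (norm (x - y))\<^sup>2) x. True"
  shows "gradg z + (2 * c) *\<^sub>R (z - y) = 0"
proof (rule GDERIV_zero_at_min)
  show "GDERIV (\<lambda>x. g x + c * (norm (x - y))\<^sup>2) z :> gradg z + (2 * c) *\<^sub>R (z - y)"
    by (intro GDERIV_add grad GDERIV_norm_diff_sq)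
  show "g z + c * (norm (z - y))\<^sup>2 \<le> g x + c * (norm (x - y))\<^sup>2" for x
    unfolding z_def
    by (rule ARG_MIN_UNIV_le[of "\<lambda>x. g x + c * (norm (x - y))\<^sup>2"])
       (intro strongly_convex_has_min[OF cvx gradient_continuous_on bdd] assms)
qed

text \<open>The resolvent form is the only property of the proximal map that the recursion of the
  algorithm uses.\<close>

lemma prox_resolvent:
  assumes "\<rho> > 0"
  shows "prox \<rho> g y + \<rho> *\<^sub>R gradg (prox \<rho> g y) = y"
proof -
  have "gradg (prox \<rho> g y) + (1 / \<rho>) *\<^sub>R (prox \<rho> g y - y) = 0"
    using ARG_MIN_stationary[of "1 / (2 * \<rho>)" y] assms by (simp add: prox_def)
  then have "\<rho> *\<^sub>R (gradg (prox \<rho> g y) + (1 / \<rho>) *\<^sub>R (prox \<rho> g y - y)) = 0" by simp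
  then show ?thesis using assms by (simp add: scaleR_add_right algebra_simps)
qed

lemma tikhonov_point_stationary:
  assumes "ipga_a a h p k / \<delta> k > 0"
  shows "gradg (tikhonov_point a h p \<delta> g k) +
    (ipga_a a h p k / \<delta> k) *\<^sub>R tikhonov_point a h p \<delta> g k = 0"
  using ARG_MIN_stationary[of "ipga_a a h p k / (2 * \<delta> k)" 0] assms
  by (simp add: tikhonov_point_def)

end

text \<open>The midpoint of two elements of least norm lies in \<open>S\<close> and would be
  strictly shorter if they differed.\<close>

lemma min_norm_element_eqI:
  fixes S :: "'a::real_inner set"
  assumes "convex S" "z \<in> S" "\<And>s. s \<in> S \<Longrightarrow> norm z \<le> norm s"
  shows "min_norm_element S = z"
proof -
  let ?w = "min_norm_element S"
  have "\<exists>z. is_arg_min norm (\<lambda>x. x \<in> S) z" using assms(2,3) by (auto simp: is_arg_min_linorder)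
  then have "is_arg_min norm (\<lambda>x. x \<in> S) ?w"
    unfolding min_norm_element_def arg_min_def by (rule someI_ex)
  then have w: "?w \<in> S" "norm ?w \<le> norm z" using assms(2) by (auto simp: is_arg_min_linorder)
  have "(1/2) *\<^sub>R ?w + (1/2) *\<^sub>R z \<in> S"
    by (rule convexD[OF assms(1)]) (use w assms in auto)
  then have "(norm z)\<^sup>2 \<le> (norm ((1/2) *\<^sub>R ?w + (1/2) *\<^sub>R z))\<^sup>2"
    using assms(3) by (intro power_mono) auto
  moreover have "(norm ?w)\<^sup>2 \<le> (norm z)\<^sup>2" using w by (intro power_mono) auto
  ultimately have "(norm (?w - z))\<^sup>2 \<le> 0"
    using norm_sq_midpoint[of ?w z 0] unfolding diff_zero by linarith
  then show ?thesis by simp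
qed

section \<open>The Tikhonov curve\<close>

text \<open>Monotonicity and the two stationarity equations give
  \<open>inner (e *\<^sub>R x - e' *\<^sub>R y) (x - y) \<le> 0\<close>. Two expansions of this
  product yield the estimate that makes the curve Cauchy and the one that bounds its speed.\<close>

lemma tikhonov_points_dist:
  fixes x y :: "'a::real_inner"
  assumes mon: "inner (G x - G y) (x - y) \<ge> 0"
    and x: "G x + e *\<^sub>R x = 0" and y: "G y + e' *\<^sub>R y = 0" and e: "0 < e'" "e' \<le> e"
  shows "(norm (x - y))\<^sup>2 \<le> (norm y)\<^sup>2 - (norm x)\<^sup>2"
    and "e * norm (x - y) \<le> (e - e') * norm y"
proof -
  have "G x = - (e *\<^sub>R x)" "G y = - (e' *\<^sub>R y)"
    using x y by (auto simp: add_eq_0_iff)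
  with mon have m: "inner (e *\<^sub>R x - e' *\<^sub>R y) (x - y) \<le> 0"
    by (simp add: inner_diff_left)
  \<comment> \<open>The expansion symmetric in \<open>x\<close> and \<open>y\<close>, which compares
    the two norms.\<close>
  have "2 * inner (e *\<^sub>R x - e' *\<^sub>R y) (x - y) =
      (e - e') * ((norm x)\<^sup>2 - (norm y)\<^sup>2) + (e + e') * (norm (x - y))\<^sup>2"
    unfolding power2_norm_eq_inner by (simp add: inner_simps inner_commute algebra_simps)
  with m have *: "(e + e') * (norm (x - y))\<^sup>2 \<le> (e - e') * ((norm y)\<^sup>2 - (norm x)\<^sup>2)"
    by (simp add: algebra_simps)
  show "(norm (x - y))\<^sup>2 \<le> (norm y)\<^sup>2 - (norm x)\<^sup>2"
  proof -
    let ?b = "(norm y)\<^sup>2 - (norm x)\<^sup>2"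
    have nonneg: "0 \<le> (e - e') * ?b" using * e
      by (smt (verit) mult_nonneg_nonneg zero_le_power2)
    show ?thesis
    proof (cases "e = e'")
      case True
      then have "(norm (x - y))\<^sup>2 \<le> 0" using * e by (simp add: mult_le_0_iff)
      then show ?thesis by simp
    next
      case False
      then have "?b \<ge> 0" using nonneg e by (simp add: zero_le_mult_iff)
      then have "(e - e') * ?b \<le> (e + e') * ?b" using e by (intro mult_right_mono) auto
      then have "(e + e') * (norm (x - y))\<^sup>2 \<le> (e + e') * ?b" using * by linarith
      then show ?thesis using e by simp
    qed
  qed
  \<comment> \<open>The asymmetric expansion: the first factor is \<open>e\<close> times
    \<open>x - y\<close> plus \<open>e - e'\<close> times \<open>y\<close>, and Cauchy-Schwarz
    handles the second part.\<close>
  have "inner (e *\<^sub>R x - e' *\<^sub>R y) (x - y) = e * (norm (x - y))\<^sup>2 + (e - e') * inner y (x - y)"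
    unfolding power2_norm_eq_inner by (simp add: inner_simps inner_commute algebra_simps)
  moreover have "- inner y (x - y) \<le> norm y * norm (x - y)"
    using norm_cauchy_schwarz[of "- y" "x - y"] by simp
  then have "(e - e') * - inner y (x - y) \<le> (e - e') * (norm y * norm (x - y))"
    using e by (intro mult_left_mono) auto
  ultimately have "norm (x - y) * (e * norm (x - y)) \<le> norm (x - y) * ((e - e') * norm y)"
    using m by (simp add: power2_eq_square algebra_simps)
  then show "e * norm (x - y) \<le> (e - e') * norm y"
    using e by (cases "x = y") auto
qed

text \<open>The curve is known only through its stationarity equation. Conditions start at
  \<open>k = 1\<close> because the parameter used later contains \<open>real k powr (- p)\<close>,
  which is \<open>0\<close> at \<open>k = 0\<close>.\<close>

locale tikhonov_curve =
  fixes g :: "'a::{real_inner, complete_space} \<Rightarrow> real" and gradg :: "'a \<Rightarrow> 'a"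
    and T :: "nat \<Rightarrow> 'a" and \<epsilon> :: "nat \<Rightarrow> real"
  assumes convex: "convex_on UNIV g"
    and gradient: "\<And>z. GDERIV g z :> gradg z"
    and argmin_nonempty: "argmin g \<noteq> {}"
    and stationary: "\<And>k. k \<ge> 1 \<Longrightarrow> gradg (T k) + \<epsilon> k *\<^sub>R T k = 0"
    and eps_pos: "\<And>k. k \<ge> 1 \<Longrightarrow> \<epsilon> k > 0"
    and eps_Suc: "\<And>k. k \<ge> 1 \<Longrightarrow> \<epsilon> (Suc k) \<le> \<epsilon> k"
    and eps_lim: "\<epsilon> \<longlonglongrightarrow> 0"
begin

lemma gradient_ge: "g y \<ge> g z + inner (gradg z) (y - z)"
  by (rule convex_GDERIV_ge[OF convex gradient])

lemma gradient_mono: "inner (gradg y - gradg z) (y - z) \<ge> 0"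
  using gradient_ge[of y z] gradient_ge[of z y] by (simp add: inner_simps)

lemma argmin_iff: "s \<in> argmin g \<longleftrightarrow> (\<forall>y. g s \<le> g y)"
  by (auto simp: argmin_def is_arg_min_linorder)

lemma gradient_zero: "s \<in> argmin g \<Longrightarrow> gradg s = 0"
  using GDERIV_zero_at_min[OF gradient] by (auto simp: argmin_iff)

lemma gradient_inner_argmin:
  assumes "s \<in> argmin g"
  shows "inner (gradg y) (y - s) \<ge> 0"
  using gradient_mono[of y s] gradient_zero[OF assms] by simp

lemma convex_argmin: "convex (argmin g)"
proof (rule convexI)
  fix y z :: 'a and u v :: real
  assume *: "y \<in> argmin g" "z \<in> argmin g" "0 \<le> u" "0 \<le> v" "u + v = 1"
  have "g (u *\<^sub>R y + v *\<^sub>R z) \<le> u * g y + v * g z"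
    using convex * by (auto simp: convex_on_def)
  also have "g y = g z" using * by (auto simp: argmin_iff intro: antisym)
  then have "u * g y + v * g z = g z" using * by (simp flip: distrib_right)
  finally show "u *\<^sub>R y + v *\<^sub>R z \<in> argmin g"
    using * by (auto simp: argmin_iff intro: order_trans)
qed

text \<open>Monotonicity of the gradient between \<open>T k\<close> and the minimiser
  \<open>s\<close> gives \<open>inner (T k) (T k) \<le> inner (T k) s\<close>; Cauchy-Schwarz
  finishes. This bounds the whole curve.\<close>

lemma norm_T_le:
  assumes s: "s \<in> argmin g" and k: "k \<ge> 1"
  shows "norm (T k) \<le> norm s"
proof -
  have "gradg (T k) = - (\<epsilon> k *\<^sub>R T k)"
    using stationary[OF k] by (auto simp: add_eq_0_iff)
  with gradient_inner_argmin[OF s, of "T k"] have "\<epsilon> k * inner (T k) (T k - s) \<le> 0" by simp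
  then have "inner (T k) (T k) \<le> inner (T k) s"
    using eps_pos[OF k] by (simp add: mult_le_0_iff inner_diff_right)
  also have "\<dots> \<le> norm (T k) * norm s" by (rule norm_cauchy_schwarz)
  finally have "norm (T k) * norm (T k) \<le> norm (T k) * norm s"
    by (simp flip: power2_norm_eq_inner add: power2_eq_square)
  then show ?thesis by (cases "T k = 0") auto
qed

lemma eps_antimono:
  assumes "1 \<le> i" "i \<le> j"
  shows "\<epsilon> j \<le> \<epsilon> i"
  using assms(2,1) by (induction j rule: dec_induct) (auto intro: order_trans[OF eps_Suc])

lemma T_step: "k \<ge> 1 \<Longrightarrow> \<epsilon> k * norm (T k - T (Suc k)) \<le> (\<epsilon> k - \<epsilon> (Suc k)) * norm (T (Suc k))"
  by (rule tikhonov_points_dist(2)[of gradg]) (auto intro: gradient_mono stationary eps_pos eps_Suc)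

text \<open>Squared norms along the curve increase and are bounded, hence Cauchy, and their
  increments dominate squared distances, so the points are Cauchy too. The limit minimises
  \<open>g\<close> and is no longer than any other minimiser.\<close>

lemma T_tendsto: "T \<longlonglongrightarrow> min_norm_element (argmin g)"
  and min_norm_element_argmin: "min_norm_element (argmin g) \<in> argmin g"
proof -
  obtain s where s: "s \<in> argmin g" using argmin_nonempty by blast
  let ?N = "\<lambda>k. (norm (T (Suc k)))\<^sup>2"
  have gap: "(norm (T i - T j))\<^sup>2 \<le> (norm (T j))\<^sup>2 - (norm (T i))\<^sup>2" if "1 \<le> i" "i \<le> j" for i j
    using that by (intro tikhonov_points_dist(1)[of gradg _ _ "\<epsilon> i" "\<epsilon> j"])
      (auto intro: gradient_mono stationary eps_pos eps_antimono)
  have "incseq ?N"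
  proof (rule incseq_SucI)
    show "?N k \<le> ?N (Suc k)" for k
      using gap[of "Suc k" "Suc (Suc k)"] zero_le_power2[of "norm (T (Suc k) - T (Suc (Suc k)))"]
      by linarith
  qed
  moreover have "?N i \<le> (norm s)\<^sup>2" for i using norm_T_le[OF s] by (simp add: power_mono)
  ultimately obtain L where "?N \<longlonglongrightarrow> L" using incseq_convergent[of ?N "(norm s)\<^sup>2"] by blast
  then have "Cauchy ?N" by (rule LIMSEQ_imp_Cauchy)
  have "Cauchy (\<lambda>k. T (Suc k))"
  proof (rule metric_CauchyI)
    fix e :: real assume "e > 0"
    then obtain M where M: "\<And>m n. m \<ge> M \<Longrightarrow> n \<ge> M \<Longrightarrow> dist (?N m) (?N n) < e\<^sup>2"
      using \<open>Cauchy ?N\<close> unfolding Cauchy_def by (meson zero_less_power)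
    have *: "dist (T (Suc m)) (T (Suc n)) < e" if "m \<ge> M" "n \<ge> M" "m \<le> n" for m n
    proof -
      have "(norm (T (Suc m) - T (Suc n)))\<^sup>2 < e\<^sup>2"
        using gap[of "Suc m" "Suc n"] M[of n m] that by (auto simp: dist_real_def)
      then show ?thesis using \<open>e > 0\<close> by (simp add: dist_norm power2_less_imp_less)
    qed
    have "dist (T (Suc m)) (T (Suc n)) < e" if "m \<ge> M" "n \<ge> M" for m n
      using *[of m n] *[of n m] that by (cases "m \<le> n") (auto simp: dist_commute)
    then show "\<exists>M. \<forall>m\<ge>M. \<forall>n\<ge>M. dist (T (Suc m)) (T (Suc n)) < e" by blast
  qed
  then obtain z where z1: "(\<lambda>k. T (Suc k)) \<longlonglongrightarrow> z" by (auto simp: Cauchy_convergent_iff convergent_def)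
  then have z: "T \<longlonglongrightarrow> z" by (simp add: filterlim_sequentially_Suc)
  have le: "norm z \<le> norm s'" if "s' \<in> argmin g" for s'
    by (rule LIMSEQ_le_const2[OF tendsto_norm[OF z]]) (use norm_T_le[OF that] in blast)
  have z_argmin: "z \<in> argmin g"
    unfolding argmin_iff
  proof
    fix y
    \<comment> \<open>Stationarity turns the error of the gradient inequality at \<open>T k\<close>
      into a multiple of \<open>\<epsilon> k\<close>, which vanishes in the limit.\<close>
    have "g (T k) \<le> g y + \<epsilon> k * norm s * (norm s + norm y)" if "k \<ge> 1" for k
    proof -
      have "g (T k) \<le> g y - inner (gradg (T k)) (y - T k)" using gradient_ge[of "T k" y] by simp
      also have "\<dots> = g y + \<epsilon> k * inner (T k) (y - T k)"
        using stationary[OF that] by (simp add: add_eq_0_iff2 inner_minus_left)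
      also have "\<dots> \<le> g y + \<epsilon> k * (norm s * (norm s + norm y))"
      proof -
        have "inner (T k) (y - T k) \<le> norm (T k) * norm (y - T k)" by (rule norm_cauchy_schwarz)
        also have "\<dots> \<le> norm s * (norm s + norm y)"
          using norm_T_le[OF s that] norm_triangle_ineq4[of y "T k"]
          by (intro mult_mono) auto
        finally show ?thesis using eps_pos[OF that] by simp
      qed
      finally show ?thesis by (simp add: mult.assoc)
    qed
    moreover have "(\<lambda>k. g (T k)) \<longlonglongrightarrow> g z"
    proof (rule isCont_tendsto_compose[OF _ z])
      show "isCont g z" using gradient[of z] unfolding gderiv_def by (rule has_derivative_continuous)
    qed
    moreover have "(\<lambda>k. g y + \<epsilon> k * norm s * (norm s + norm y)) \<longlonglongrightarrow> g y + 0 * norm s * (norm s + norm y)"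
      by (intro tendsto_intros eps_lim)
    ultimately have "g z \<le> g y + 0 * norm s * (norm s + norm y)"
      by (intro LIMSEQ_le) auto
    then show "g z \<le> g y" by simp
  qed
  with le have "min_norm_element (argmin g) = z"
    by (intro min_norm_element_eqI convex_argmin) auto
  with z z_argmin show "T \<longlonglongrightarrow> min_norm_element (argmin g)"
    and "min_norm_element (argmin g) \<in> argmin g" by simp_all
qed

end

section \<open>One-step energy estimates\<close>

lemma norm_add_sq: "(norm (u + v))\<^sup>2 = (norm u)\<^sup>2 + 2 * inner u v + (norm (v::'a::real_inner))\<^sup>2"
  unfolding power2_norm_eq_inner by (simp add: inner_simps inner_commute)

lemma inner_young:
  fixes u v :: "'a::real_inner"
  assumes "t > 0"
  shows "inner u v \<le> t / 2 * (norm u)\<^sup>2 + 1 / (2 * t) * (norm v)\<^sup>2"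
proof -
  have "0 \<le> (norm (t *\<^sub>R u - v))\<^sup>2" by simp
  also have "\<dots> = t\<^sup>2 * (norm u)\<^sup>2 - 2 * t * inner u v + (norm v)\<^sup>2"
    unfolding power2_norm_eq_inner by (simp add: inner_simps inner_commute power2_eq_square)
  finally show ?thesis using assms by (simp add: field_simps power2_eq_square)
qed

lemma norm_add3_sq:
  fixes u v w :: "'a::real_inner"
  shows "(norm (u + v + w))\<^sup>2 \<le> 3 * ((norm u)\<^sup>2 + (norm v)\<^sup>2 + (norm w)\<^sup>2)"
proof -
  have "0 \<le> (norm (u - v))\<^sup>2 + (norm (v - w))\<^sup>2 + (norm (u - w))\<^sup>2" by simp
  also have "\<dots> = 3 * ((norm u)\<^sup>2 + (norm v)\<^sup>2 + (norm w)\<^sup>2) - (norm (u + v + w))\<^sup>2"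
    unfolding power2_norm_eq_inner by (simp add: inner_simps inner_commute)
  finally show ?thesis by simp
qed

text \<open>State and coefficients are separate arguments, so that a step can be split in two: first
  the state moves with \<open>l\<close> and the minimiser frozen, then the coefficients move with
  the state frozen.\<close>

definition energy :: "real \<Rightarrow> real \<Rightarrow> 'a::real_inner \<Rightarrow> 'a \<Rightarrow> real" where
  "energy l \<Phi> z u = (norm (l *\<^sub>R z + u))\<^sup>2 / 2 + \<Phi> + l\<^sup>2 * (norm z)\<^sup>2 / 2"

text \<open>Here \<open>y\<close> is the new iterate, \<open>d\<close> its gradient,
  \<open>F\<close> the gradient of the regularised objective, \<open>v\<close> the displacement and
  \<open>z\<close> the offset from the Tikhonov point. The damping is \<open>2 * l\<close> so that
  the cross terms \<open>inner z v\<close> cancel; the surplus left over is then compared with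
  \<open>R\<close> times the new energy.\<close>

lemma energy_decrease:
  fixes v d s y z F :: "'a::real_inner"
  assumes F: "F = D *\<^sub>R d + b *\<^sub>R y"
    and pos: "0 < l" "0 < b" "0 < D" "0 < B" "0 \<le> R"
    and descent: "\<Phi>' - \<Phi> \<le> inner F v"
    and strong: "inner z F \<ge> \<Phi>' + b / 2 * (norm z)\<^sup>2"
    and mon: "inner d (y - s) \<ge> 0" and nonneg: "\<Phi>' \<ge> 0"
    and R: "3 * R \<le> l" "4 * R * l \<le> b" "3 * B * R + B * l \<le> D"
  shows "(1 + R) * energy l \<Phi>' z (v + B *\<^sub>R d) \<le>
    energy l \<Phi> (z - v) (v + B *\<^sub>R d + (2 * l) *\<^sub>R v + F) + B * b\<^sup>2 / (2 * D) * (norm s)\<^sup>2"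
proof -
  define W where "W = l *\<^sub>R z + (v + B *\<^sub>R d)"
  define Q where "Q = l *\<^sub>R v + F"
  let ?e' = "energy l \<Phi>' z (v + B *\<^sub>R d)"
  let ?e = "energy l \<Phi> (z - v) (v + B *\<^sub>R d + (2 * l) *\<^sub>R v + F)"
  have W: "l *\<^sub>R (z - v) + (v + B *\<^sub>R d + (2 * l) *\<^sub>R v + F) = W + Q"
  proof -
    have "(2 * l) *\<^sub>R v = l *\<^sub>R v + l *\<^sub>R v" by (simp flip: scaleR_left_distrib)
    then show ?thesis unfolding W_def Q_def by (simp add: scaleR_diff_right algebra_simps)
  qed
  have Q: "?e - ?e' = inner W Q + (norm Q)\<^sup>2 / 2 + (\<Phi> - \<Phi>')
      + l\<^sup>2 / 2 * ((norm v)\<^sup>2 - 2 * inner z v)"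
    unfolding energy_def W W_def[symmetric]
    using norm_add_sq[of W Q] norm_add_sq[of z "- v"] by (simp add: algebra_simps) algebra
  \<comment> \<open>The nonnegative terms in \<open>(norm Q)\<^sup>2\<close> and
    \<open>(norm v)\<^sup>2\<close> are dropped. The remaining \<open>inner z v\<close> cancels
    against the one inside \<open>inner W Q\<close>.\<close>
  have "?e - ?e' \<ge> inner W Q + (\<Phi> - \<Phi>') - l\<^sup>2 * inner z v"
    unfolding Q by (simp add: algebra_simps)
  moreover have "inner W Q = l\<^sup>2 * inner z v + l * inner z F + l * (norm v)\<^sup>2 + inner F v
      + B * l * inner d v + B * D * (norm d)\<^sup>2 + B * b * inner d y"
    unfolding W_def Q_def F power2_norm_eq_inner
    by (simp add: inner_simps inner_commute power2_eq_square algebra_simps)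
  \<comment> \<open>Weight \<open>B\<close> in Young's inequality spends only half of the
    dissipation \<open>l * (norm v)\<^sup>2\<close>.\<close>
  moreover have "B * l * inner d v \<ge> - (B\<^sup>2 * l / 2 * (norm d)\<^sup>2) - l / 2 * (norm v)\<^sup>2"
  proof -
    have "inner (- d) v \<le> B / 2 * (norm (- d))\<^sup>2 + 1 / (2 * B) * (norm v)\<^sup>2"
      by (rule inner_young) (use pos in auto)
    then have "B * l * inner (- d) v \<le> B * l * (B / 2 * (norm (- d))\<^sup>2 + 1 / (2 * B) * (norm v)\<^sup>2)"
      by (rule mult_left_mono) (use pos in auto)
    also have "\<dots> = B\<^sup>2 * l / 2 * (norm d)\<^sup>2 + l / 2 * (norm v)\<^sup>2"
      using pos by (simp add: field_simps power2_eq_square)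
    finally show ?thesis by simp
  qed
  \<comment> \<open>Writing \<open>y\<close> as \<open>(y - s) + s\<close>, the first part has the
    good sign. The weight \<open>D / b\<close> lets half of \<open>B * D * (norm d)\<^sup>2\<close>
    absorb the second, leaving the error in \<open>s\<close>.\<close>
  moreover have "B * b * inner d y \<ge> - (B * D / 2 * (norm d)\<^sup>2) - B * b\<^sup>2 / (2 * D) * (norm s)\<^sup>2"
  proof -
    have "inner (- d) s \<le> (D / b) / 2 * (norm (- d))\<^sup>2 + 1 / (2 * (D / b)) * (norm s)\<^sup>2"
      by (rule inner_young) (use pos in auto)
    then have "inner (- d) y \<le> (D / b) / 2 * (norm d)\<^sup>2 + 1 / (2 * (D / b)) * (norm s)\<^sup>2"
      using mon by (simp add: inner_diff_right)
    then have "B * b * inner (- d) y \<le> B * b * ((D / b) / 2 * (norm d)\<^sup>2 + 1 / (2 * (D / b)) * (norm s)\<^sup>2)"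
      by (rule mult_left_mono) (use pos in auto)
    also have "\<dots> = B * D / 2 * (norm d)\<^sup>2 + B * b\<^sup>2 / (2 * D) * (norm s)\<^sup>2"
      using pos by (simp add: field_simps power2_eq_square)
    finally show ?thesis by simp
  qed
  moreover have "l * inner z F \<ge> l * \<Phi>' + l * b / 2 * (norm z)\<^sup>2"
    using mult_left_mono[OF strong, of l] pos by (simp add: algebra_simps)
  ultimately have main: "?e - ?e' + B * b\<^sup>2 / (2 * D) * (norm s)\<^sup>2 \<ge>
      l * \<Phi>' + l * b / 2 * (norm z)\<^sup>2 + l / 2 * (norm v)\<^sup>2
      + (B * D / 2 - B\<^sup>2 * l / 2) * (norm d)\<^sup>2"
    using descent by (simp add: algebra_simps)
  \<comment> \<open>Each condition on \<open>R\<close> matches one of these terms: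
    \<open>3 * R \<le> l\<close> for \<open>v\<close> and the value,
    \<open>4 * R * l \<le> b\<close> for \<open>z\<close>, and the last one for
    \<open>d\<close>.\<close>
  have "?e' \<le> 2 * l\<^sup>2 * (norm z)\<^sup>2 + 3 / 2 * (norm v)\<^sup>2 + 3 / 2 * B\<^sup>2 * (norm d)\<^sup>2 + \<Phi>'"
    using norm_add3_sq[of "l *\<^sub>R z" v "B *\<^sub>R d"] unfolding energy_def
    by (simp add: power_mult_distrib add.assoc)
  then have "R * ?e' \<le> R * (2 * l\<^sup>2 * (norm z)\<^sup>2 + 3 / 2 * (norm v)\<^sup>2 + 3 / 2 * B\<^sup>2 * (norm d)\<^sup>2 + \<Phi>')"
    using pos by (intro mult_left_mono)
  also have "\<dots> = (l / 2 * (4 * R * l)) * (norm z)\<^sup>2 + (3 * R / 2) * (norm v)\<^sup>2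
      + (B / 2 * (3 * B * R)) * (norm d)\<^sup>2 + R * \<Phi>'"
    by (simp add: power2_eq_square algebra_simps)
  also have "\<dots> \<le> (l / 2 * b) * (norm z)\<^sup>2 + (l / 2) * (norm v)\<^sup>2
      + (B / 2 * (D - B * l)) * (norm d)\<^sup>2 + l * \<Phi>'"
    using R pos nonneg by (intro add_mono mult_right_mono mult_left_mono) auto
  finally show ?thesis using main
    by (simp add: algebra_simps power2_eq_square add_divide_distrib diff_divide_distrib)
qed

lemma norm_diff_sq_le:
  fixes u v :: "'a::real_inner"
  assumes "t > 0"
  shows "(norm (u - v))\<^sup>2 \<le> (1 + t) * (norm u)\<^sup>2 + (1 + 1 / t) * (norm v)\<^sup>2"
proof -
  have "inner (- u) v \<le> t / 2 * (norm u)\<^sup>2 + 1 / t * (norm v)\<^sup>2 / 2"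
    using inner_young[OF assms, of "- u" v] by simp
  moreover have "(norm (u - v))\<^sup>2 = (norm u)\<^sup>2 + 2 * inner (- u) v + (norm v)\<^sup>2"
    using norm_add_sq[of u "- v"] by simp
  ultimately show ?thesis by (simp add: algebra_simps)
qed

text \<open>\<open>\<kappa>\<close> bounds the relative change of the coefficients and
  \<open>\<omega>\<close> the motion of the Tikhonov point. The weight \<open>t\<close> trades
  growth of the energy against the cost \<open>1 / t\<close> of these perturbations; it is later a
  quarter of the contraction rate.\<close>

lemma energy_drift:
  fixes z w u :: "'a::real_inner"
  assumes t: "0 < t" "\<kappa> \<le> t" "0 \<le> \<kappa>" and l: "0 \<le> l'" "l' \<le> l" "l - l' \<le> \<kappa> * l"
    and w: "norm w \<le> \<omega>" and \<Phi>: "\<Phi>' \<le> (1 + \<kappa>) * \<Phi> + f" "0 \<le> \<Phi>"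
  shows "energy l' \<Phi>' (z - w) u \<le>
    (1 + t + 2 * (1 + 1 / t) * \<kappa>\<^sup>2) * energy l \<Phi> z u + 3 / 2 * (1 + 1 / t) * l\<^sup>2 * \<omega>\<^sup>2 + f"
proof -
  define W where "W = l *\<^sub>R z + u"
  define m where "m = (l - l') *\<^sub>R z + l' *\<^sub>R w"
  define c where "c = 1 + 1 / t"
  have c: "c \<ge> 0" using t by (simp add: c_def)
  have \<omega>: "(norm w)\<^sup>2 \<le> \<omega>\<^sup>2" using w by (simp add: power_mono)
  have "l' *\<^sub>R (z - w) + u = W - m" by (simp add: W_def m_def algebra_simps)
  then have eq: "energy l' \<Phi>' (z - w) u = (norm (W - m))\<^sup>2 / 2 + \<Phi>' + l'\<^sup>2 * (norm (z - w))\<^sup>2 / 2"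
    by (simp add: energy_def)
  have m: "(norm m)\<^sup>2 \<le> 2 * (\<kappa> * l)\<^sup>2 * (norm z)\<^sup>2 + 2 * l\<^sup>2 * \<omega>\<^sup>2"
  proof -
    have "(norm m)\<^sup>2 \<le> 2 * (norm ((l - l') *\<^sub>R z))\<^sup>2 + 2 * (norm (l' *\<^sub>R w))\<^sup>2"
      using norm_diff_sq_le[of 1 "(l - l') *\<^sub>R z" "- (l' *\<^sub>R w)"] by (simp add: m_def)
    also have "\<dots> = 2 * (l - l')\<^sup>2 * (norm z)\<^sup>2 + 2 * (l'\<^sup>2 * (norm w)\<^sup>2)"
      by (simp add: power_mult_distrib)
    also have "\<dots> \<le> 2 * (\<kappa> * l)\<^sup>2 * (norm z)\<^sup>2 + 2 * (l\<^sup>2 * \<omega>\<^sup>2)"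
      using l w \<omega> by (intro add_mono mult_mono mult_right_mono mult_left_mono power_mono) auto
    finally show ?thesis by simp
  qed
  have 1: "(norm (W - m))\<^sup>2 \<le> (1 + t) * (norm W)\<^sup>2 + c * (2 * (\<kappa> * l)\<^sup>2 * (norm z)\<^sup>2 + 2 * l\<^sup>2 * \<omega>\<^sup>2)"
    using norm_diff_sq_le[OF t(1), of W m] mult_left_mono[OF m c] unfolding c_def by linarith
  have "l'\<^sup>2 * (norm (z - w))\<^sup>2 \<le> l\<^sup>2 * ((1 + t) * (norm z)\<^sup>2 + c * \<omega>\<^sup>2)"
  proof (rule mult_mono)
    show "(norm (z - w))\<^sup>2 \<le> (1 + t) * (norm z)\<^sup>2 + c * \<omega>\<^sup>2"
      using norm_diff_sq_le[OF t(1), of z w] mult_left_mono[OF \<omega> c] unfolding c_def by linarith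
  qed (use l in \<open>auto intro: power_mono\<close>)
  moreover have "\<Phi>' \<le> (1 + t) * \<Phi> + f"
    using \<Phi> mult_right_mono[OF t(2) \<Phi>(2)] by (simp add: algebra_simps)
  \<comment> \<open>The last summand of the energy controls
    \<open>l\<^sup>2 * (norm z)\<^sup>2\<close>, so the change of \<open>l\<close> costs a multiple
    of the energy and no forcing.\<close>
  moreover have "c * \<kappa>\<^sup>2 * (l\<^sup>2 * (norm z)\<^sup>2) \<le> c * \<kappa>\<^sup>2 * (2 * energy l \<Phi> z u)"
    using c \<Phi> by (intro mult_left_mono) (auto simp: energy_def)
  ultimately show ?thesis
    using 1 unfolding eq unfolding energy_def W_def[symmetric] c_def[symmetric]
    by (simp add: algebra_simps power_mult_distrib add_divide_distrib)
qed

section \<open>Energy decay along the iteration\<close>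

lemma eventually_powr_dominates:
  fixes a b c K :: real
  assumes "a < b" "c > 0"
  shows "eventually (\<lambda>k. K * real k powr a \<le> c * real k powr b) sequentially"
proof -
  have "(\<lambda>k. K * real k powr (a - b)) \<longlonglongrightarrow> K * 0"
    by (intro tendsto_mult tendsto_const tendsto_neg_powr filterlim_real_sequentially) (use assms in simp)
  then have "eventually (\<lambda>k. K * real k powr (a - b) < c) sequentially"
    using assms by (intro order_tendstoD(2)) auto
  then show ?thesis
  proof (eventually_elim, goal_cases)
    case (1 k)
    then have "K * real k powr (a - b) * real k powr b \<le> c * real k powr b"
      by (intro mult_right_mono) auto
    then show ?case by (simp flip: powr_add add: mult.assoc)
  qed
qed

text \<open>With \<open>y = (k + 1) / k\<close>, \<open>y powr (- a) = exp (- a * ln y) \<ge> 1 - a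
  * ln y \<ge> 1 - a / k\<close>.\<close>

lemma powr_decrement_le:
  fixes a :: real
  assumes "a \<ge> 0" "k \<ge> 1"
  shows "real k powr (- a) - real (Suc k) powr (- a) \<le> a / real k * real k powr (- a)"
proof -
  define y where "y = real (Suc k) / real k"
  have y: "y > 0" and y1: "y = 1 + 1 / real k" using assms by (auto simp: y_def field_simps)
  have "ln y \<le> 1 / real k" unfolding y1 by (rule ln_add_one_self_le_self) simp
  then have "1 - a / real k \<le> 1 + (- a) * ln y"
    using mult_left_mono[of "ln y" "1 / real k" a] assms by simp
  also have "\<dots> \<le> y powr (- a)"
    using y exp_ge_add_one_self[of "(- a) * ln y"] by (simp add: powr_def)
  finally have "real k powr (- a) * (1 - a / real k) \<le> real k powr (- a) * y powr (- a)"
    by (rule mult_left_mono) simp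
  also have "\<dots> = real (Suc k) powr (- a)"
    using assms by (simp add: y_def flip: powr_mult)
  finally show ?thesis by (simp add: algebra_simps)
qed

text \<open>A multiple of \<open>real k powr (- \<sigma>)\<close> is a supersolution: half of the
  contraction absorbs the forcing, the other half pays for the decrease of this power, which is only
  of relative order \<open>1 / k\<close> and hence smaller because \<open>s < 1\<close>.\<close>

lemma discrete_gronwall_powr:
  fixes e :: "nat \<Rightarrow> real"
  assumes c: "c > 0" and s: "0 < s" "s < 1" and \<sigma>: "\<sigma> \<ge> 0"
    and rec: "eventually (\<lambda>k. e (Suc k) \<le> (1 - c * real k powr (- s)) * e k
      + M * real k powr (- (\<sigma> + s))) sequentially"
  shows "\<exists>C\<ge>0. eventually (\<lambda>k. e k \<le> C * real k powr (- \<sigma>)) sequentially"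
proof -
  have "eventually (\<lambda>k. k \<ge> 1 \<and>
      e (Suc k) \<le> (1 - c * real k powr (- s)) * e k + M * real k powr (- (\<sigma> + s)) \<and>
      c * real k powr (- s) \<le> 1 * real k powr 0 \<and>
      \<sigma> * real k powr (- 1) \<le> c / 2 * real k powr (- s)) sequentially"
    by (intro eventually_conj eventually_ge_at_top rec eventually_powr_dominates) (use s c in auto)
  then obtain N where N: "\<And>k. k \<ge> N \<Longrightarrow> k \<ge> 1"
    "\<And>k. k \<ge> N \<Longrightarrow> e (Suc k) \<le> (1 - c * real k powr (- s)) * e k + M * real k powr (- (\<sigma> + s))"
    "\<And>k. k \<ge> N \<Longrightarrow> c * real k powr (- s) \<le> 1 * real k powr 0"
    "\<And>k. k \<ge> N \<Longrightarrow> \<sigma> * real k powr (- 1) \<le> c / 2 * real k powr (- s)"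
    unfolding eventually_sequentially by blast
  \<comment> \<open>The entries give nonnegativity, absorption of the forcing by half the
    contraction, and the base case at \<open>N\<close>.\<close>
  define C where "C = max 0 (max (2 * M / c) (e N * real N powr \<sigma>))"
  have C: "C \<ge> 0" "2 * M / c \<le> C" "e N * real N powr \<sigma> \<le> C"
    by (auto simp: C_def)
  then have M: "M \<le> c / 2 * C" using c by (simp add: field_simps)
  have "e k \<le> C * real k powr (- \<sigma>)" if "k \<ge> N" for k
    using that
  proof (induction k rule: dec_induct)
    case base
    have "e N * real N powr \<sigma> * real N powr (- \<sigma>) \<le> C * real N powr (- \<sigma>)"
      using C by (intro mult_right_mono) auto
    then show ?case using N(1)[of N] by (simp add: mult.assoc flip: powr_add)
  next
    case (step k)
    have k: "k \<ge> 1" using N(1)[of k] step by simp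
    have small: "c * real k powr (- s) \<le> 1" using N(3)[of k] step k by simp
    have "e (Suc k) \<le> (1 - c * real k powr (- s)) * e k + M * real k powr (- (\<sigma> + s))"
      using N(2) step by simp
    also have "\<dots> \<le> (1 - c * real k powr (- s)) * (C * real k powr (- \<sigma>))
        + c / 2 * C * real k powr (- (\<sigma> + s))"
      using step C M small by (intro add_mono mult_left_mono mult_right_mono) auto
    also have "real k powr (- (\<sigma> + s)) = real k powr (- \<sigma>) * real k powr (- s)"
      by (simp flip: powr_add)
    also have "(1 - c * real k powr (- s)) * (C * real k powr (- \<sigma>))
        + c / 2 * C * (real k powr (- \<sigma>) * real k powr (- s))
        = C * (real k powr (- \<sigma>) - real k powr (- \<sigma>) * (c / 2 * real k powr (- s)))"
      by (simp add: algebra_simps)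
    also have "\<dots> \<le> C * (real k powr (- \<sigma>) - real k powr (- \<sigma>) * (\<sigma> * real k powr (- 1)))"
      using N(4)[of k] step C by (intro mult_left_mono diff_left_mono) auto
    also have "\<dots> \<le> C * real (Suc k) powr (- \<sigma>)"
      using powr_decrement_le[OF \<sigma> k] C k
      by (intro mult_left_mono) (auto simp: powr_minus_divide mult_ac)
    finally show ?case .
  qed
  with C(1) show ?thesis unfolding eventually_sequentially by blast
qed

text \<open>The algorithm with the step size \<open>h\<close> absorbed: \<open>D k\<close> is
  \<open>h\<^sup>2 * \<delta> k\<close>, \<open>B\<close> is \<open>\<beta> * h\<close>, and
  \<open>A\<close>, \<open>E\<close> collect the powers of \<open>h\<close> in the damping and the
  regularisation.\<close>

locale inertial_tikhonov = tikhonov_curve g gradg T "\<lambda>k. E * real k powr (- p) / D k"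
  for g :: "'a::{real_inner, complete_space} \<Rightarrow> real" and gradg :: "'a \<Rightarrow> 'a"
    and T :: "nat \<Rightarrow> 'a" and E p :: real and D :: "nat \<Rightarrow> real" +
  fixes x :: "nat \<Rightarrow> 'a" and A B q K :: real and s :: 'a
  assumes A: "A > 0" and B: "B > 0" and E: "E > 0"
    and q: "0 < q" "q < 1" and p: "1 < p" "p < q + 1"
    and D_pos: "\<And>k. D k > 0" and D_mono: "mono D" and D_lim: "filterlim D at_top sequentially"
    and D_growth: "eventually (\<lambda>k. D (Suc k) \<le> (1 + K / real k) * D k) sequentially" and K: "K \<ge> 0"
    and s_argmin: "s \<in> argmin g"
    and recursion: "\<And>k. k \<ge> 1 \<Longrightarrow>
      x k - x (k - 1) + B *\<^sub>R gradg (x k) =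
      x (Suc k) - x k + B *\<^sub>R gradg (x (Suc k)) + (A * real k powr (- q)) *\<^sub>R (x (Suc k) - x k)
      + (D k *\<^sub>R gradg (x (Suc k)) + (E * real k powr (- p)) *\<^sub>R x (Suc k))"
begin

text \<open>Half of the damping coefficient in the recursion, as the cancellation in
  \<open>energy_decrease\<close> requires.\<close>

definition damp :: "nat \<Rightarrow> real" where "damp k = A / 2 * real k powr (- q)"
definition reg :: "nat \<Rightarrow> real" where "reg k = E * real k powr (- p)"
text \<open>Subtracting \<open>D k * g s\<close> leaves \<open>gap\<close> unchanged and makes both
  summands nonnegative.\<close>

definition objective :: "nat \<Rightarrow> 'a \<Rightarrow> real" where
  "objective k y = D k * (g y - g s) + reg k / 2 * (norm y)\<^sup>2"
definition gap :: "nat \<Rightarrow> 'a \<Rightarrow> real" where "gap k y = objective k y - objective k (T k)"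
definition vel :: "nat \<Rightarrow> 'a" where "vel k = x k - x (k - 1) + B *\<^sub>R gradg (x k)"
definition total_energy :: "nat \<Rightarrow> real" where
  "total_energy k = energy (damp k) (gap k (x k)) (x k - T k) (vel k)"

text \<open>The energy contracts by a factor \<open>1 - c * k powr - s0\<close> per step against a forcing of order
  \<open>k powr - (\<sigma> + s0)\<close>, which balances at order \<open>k powr - \<sigma>\<close>. The three regimes of
  the theorem are the possible values of the maximum and the minimum.\<close>

definition s0 :: real where "s0 = max q (p - q)"
definition \<sigma> :: real where "\<sigma> = min (p + 1 - s0) (2 * q + 2 - 2 * s0)"

lemma s0: "q \<le> s0" "p \<le> s0 + q" "0 < s0" "s0 < 1"
  using p q by (auto simp: s0_def)

lemma \<sigma>_pos: "\<sigma> > 0" using s0 p q by (auto simp: \<sigma>_def)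

lemma reg_pos: "k \<ge> 1 \<Longrightarrow> reg k > 0" using E by (simp add: reg_def)
lemma damp_pos: "k \<ge> 1 \<Longrightarrow> damp k > 0" using A by (simp add: damp_def)

lemma D_ge: "D 0 \<le> D k" using D_mono by (simp add: monoD)

lemma g_ge: "g s \<le> g y" using s_argmin by (auto simp: argmin_iff)

section \<open>Strong convexity of the regularised objective\<close>

lemma objective_gradient_ge:
  "objective k y \<ge> objective k z + inner (D k *\<^sub>R gradg z + reg k *\<^sub>R z) (y - z)
    + reg k / 2 * (norm (y - z))\<^sup>2"
proof -
  have "D k * (g y - g s) \<ge> D k * (g z - g s) + D k * inner (gradg z) (y - z)"
    using mult_left_mono[OF gradient_ge[of z y], of "D k"] D_pos[of k] by (simp add: algebra_simps)
  moreover have sq: "(norm y)\<^sup>2 = (norm z)\<^sup>2 + 2 * inner z (y - z) + (norm (y - z))\<^sup>2"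
    using norm_add_sq[of z "y - z"] by simp
  have "reg k / 2 * (norm y)\<^sup>2 =
      reg k / 2 * (norm z)\<^sup>2 + reg k * inner z (y - z) + reg k / 2 * (norm (y - z))\<^sup>2"
    unfolding sq by (simp add: distrib_left)
  ultimately show ?thesis by (simp add: objective_def inner_add_left add_divide_distrib)
qed

lemma T_gradient:
  assumes "k \<ge> 1" shows "D k *\<^sub>R gradg (T k) + reg k *\<^sub>R T k = 0"
proof -
  have "D k *\<^sub>R (gradg (T k) + (E * real k powr (- p) / D k) *\<^sub>R T k) = 0"
    using stationary[OF assms] by simp
  then show ?thesis using D_pos[of k] by (simp add: scaleR_add_right reg_def)
qed

lemma gap_ge: "k \<ge> 1 \<Longrightarrow> gap k y \<ge> reg k / 2 * (norm (y - T k))\<^sup>2"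
  using objective_gradient_ge[of k "T k" y] T_gradient[of k] by (simp add: gap_def)

lemma gap_nonneg: "k \<ge> 1 \<Longrightarrow> gap k y \<ge> 0"
  using gap_ge[of k y] reg_pos[of k] by (smt (verit) divide_nonneg_nonneg mult_nonneg_nonneg zero_le_power2)

lemma objective_T_le:
  assumes "k \<ge> 1" shows "objective k (T k) \<le> reg k / 2 * (norm s)\<^sup>2"
  using gap_nonneg[OF assms, of s] by (simp add: gap_def objective_def)

text \<open>Values of \<open>g\<close> are recovered from the gap at the price of the minimal
  objective value, which is at most the value at \<open>s\<close>.\<close>

lemma D_gap_le:
  assumes "k \<ge> 1" shows "D k * (g y - g s) \<le> gap k y + reg k / 2 * (norm s)\<^sup>2"
  using objective_T_le[OF assms] reg_pos[OF assms] unfolding gap_def objective_def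
  by (smt (verit) divide_nonneg_nonneg mult_nonneg_nonneg zero_le_power2)

lemma reg_mono: assumes "k \<ge> 1" shows "reg (Suc k) \<le> reg k"
  using E p assms by (auto simp: reg_def intro!: powr_mono2')

lemma damp_mono: assumes "k \<ge> 1" shows "damp (Suc k) \<le> damp k"
  using A q assms by (auto simp: damp_def intro!: powr_mono2')

text \<open>The state advances while coefficients and \<open>T k\<close> stay fixed. The recursion
  identifies \<open>vel k\<close> with the old velocity expected by \<open>energy_decrease\<close>;
  descent and strong convexity are the gradient inequality at \<open>x (Suc k)\<close>, tested at
  \<open>x k\<close> and at \<open>T k\<close>.\<close>

lemma frozen_step:
  assumes k: "k \<ge> 1" and R: "0 \<le> R" "3 * R \<le> damp k" "4 * R * damp k \<le> reg k"
    "3 * B * R + B * damp k \<le> D k"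
  shows "(1 + R) * energy (damp k) (gap k (x (Suc k))) (x (Suc k) - T k) (vel (Suc k)) \<le>
    total_energy k + B * (reg k)\<^sup>2 / (2 * D k) * (norm s)\<^sup>2"
proof -
  define v where "v = x (Suc k) - x k"
  define d where "d = gradg (x (Suc k))"
  define F where "F = D k *\<^sub>R d + reg k *\<^sub>R x (Suc k)"
  have "(1 + R) * energy (damp k) (gap k (x (Suc k))) (x (Suc k) - T k) (v + B *\<^sub>R d) \<le>
    energy (damp k) (gap k (x k)) (x (Suc k) - T k - v) (v + B *\<^sub>R d + (2 * damp k) *\<^sub>R v + F)
    + B * (reg k)\<^sup>2 / (2 * D k) * (norm s)\<^sup>2"
  proof (rule energy_decrease[OF F_def])
    have nn: "0 \<le> reg k / 2 * (norm v)\<^sup>2" using reg_pos[OF k] by simp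
    have "objective k (x k) \<ge> objective k (x (Suc k)) + inner F (x k - x (Suc k))
        + reg k / 2 * (norm v)\<^sup>2"
      using objective_gradient_ge[of k "x (Suc k)" "x k"]
      unfolding F_def d_def v_def by (simp add: norm_minus_commute)
    then show "gap k (x (Suc k)) - gap k (x k) \<le> inner F v"
      using nn by (simp add: gap_def v_def inner_diff_right)
    have "objective k (T k) \<ge> objective k (x (Suc k)) + inner F (T k - x (Suc k))
        + reg k / 2 * (norm (x (Suc k) - T k))\<^sup>2"
      using objective_gradient_ge[of k "x (Suc k)" "T k"]
      unfolding F_def d_def by (simp add: norm_minus_commute)
    then show "inner (x (Suc k) - T k) F \<ge> gap k (x (Suc k)) + reg k / 2 * (norm (x (Suc k) - T k))\<^sup>2"
      by (simp add: gap_def inner_diff_right inner_diff_left inner_commute)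
    show "inner d (x (Suc k) - s) \<ge> 0" unfolding d_def by (rule gradient_inner_argmin[OF s_argmin])
  qed (use k R B reg_pos damp_pos D_pos gap_nonneg in auto)
  moreover have "v + B *\<^sub>R d = vel (Suc k)" by (simp add: v_def d_def vel_def)
  moreover have "v + B *\<^sub>R d + (2 * damp k) *\<^sub>R v + F = vel k"
    using recursion[OF k] by (simp add: v_def d_def F_def vel_def damp_def reg_def)
  moreover have "x (Suc k) - T k - v = x k - T k" by (simp add: v_def)
  ultimately show ?thesis by (simp add: total_energy_def)
qed

text \<open>A common constant: \<open>D\<close>, \<open>reg\<close>, \<open>damp\<close> and the
  Tikhonov parameter all change by a fraction of at most \<open>\<kappa> / k\<close> per step. The
  sum is dictated by the parameter, a quotient of \<open>reg\<close> and \<open>D\<close>.\<close>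

definition \<kappa> :: real where "\<kappa> = K + p"

lemma \<kappa>: "\<kappa> \<ge> 0" "K \<le> \<kappa>" "q \<le> \<kappa>" "p \<le> \<kappa>" using K p q by (auto simp: \<kappa>_def)

lemma T_drift:
  assumes k: "k \<ge> 1" and growth: "D (Suc k) \<le> (1 + K / real k) * D k"
  shows "norm (T (Suc k) - T k) \<le> \<kappa> / real k * norm s"
proof -
  let ?e = "\<lambda>k. E * real k powr (- p) / D k"
  \<comment> \<open>Inverts the growth bound through
    \<open>(1 - K / k) * (1 + K / k) \<le> 1\<close>; a negative left side is trivial.\<close>
  have "1 - K / real k \<le> D k / D (Suc k)"
  proof -
    have Kk: "K / real k \<ge> 0" using K by simp
    have "(1 - K / real k) * D (Suc k) \<le> D k"
    proof (cases "1 - K / real k \<ge> 0")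
      case True
      then have "(1 - K / real k) * D (Suc k) \<le> (1 - K / real k) * ((1 + K / real k) * D k)"
        using growth by (intro mult_left_mono)
      also have "\<dots> = D k - (K / real k)\<^sup>2 * D k"
        using k by (simp add: field_simps power2_eq_square)
      also have "\<dots> \<le> D k" using D_pos[of k] by simp
      finally show ?thesis .
    next
      case False
      then have "(1 - K / real k) * D (Suc k) \<le> 0" using D_pos[of "Suc k"]
        by (simp add: mult_le_0_iff)
      then show ?thesis using D_pos[of k] by simp
    qed
    then show ?thesis using D_pos[of "Suc k"] by (simp add: field_simps)
  qed
  have le1: "D k / D (Suc k) \<le> 1" using D_pos[of "Suc k"] D_mono by (simp add: monoD)
  have "?e k - ?e (Suc k) \<le> \<kappa> / real k * ?e k"
  proof -
    let ?y = "D k / D (Suc k)"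
    \<comment> \<open>The change of the quotient is separated into the growth of \<open>D\<close>
      and the decay of the power.\<close>
    have "real k powr (- p) - ?y * real (Suc k) powr (- p)
        = (1 - ?y) * real k powr (- p) + ?y * (real k powr (- p) - real (Suc k) powr (- p))"
      by (simp add: algebra_simps)
    also have "\<dots> \<le> K / real k * real k powr (- p) + 1 * (p / real k * real k powr (- p))"
    proof (intro add_mono mult_mono mult_right_mono)
      show "real k powr (- p) - real (Suc k) powr (- p) \<le> p / real k * real k powr (- p)"
        using powr_decrement_le[of p k] p k by simp
      show "0 \<le> real k powr (- p) - real (Suc k) powr (- p)"
        using p k by (auto intro!: powr_mono2')
    qed (use \<open>1 - K / real k \<le> ?y\<close> le1 in auto)
    also have "\<dots> = \<kappa> / real k * real k powr (- p)"
      by (simp add: \<kappa>_def algebra_simps add_divide_distrib)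
    finally have "E / D k * (real k powr (- p) - ?y * real (Suc k) powr (- p))
        \<le> E / D k * (\<kappa> / real k * real k powr (- p))"
      using E D_pos[of k] by (intro mult_left_mono) auto
    then show ?thesis using D_pos[of k] by (simp add: right_diff_distrib mult_ac)
  qed
  have pos: "?e k > 0" using eps_pos[OF k] .
  have nn: "0 \<le> ?e k - ?e (Suc k)" using eps_Suc[OF k] by simp
  have "?e k * norm (T k - T (Suc k)) \<le> (?e k - ?e (Suc k)) * norm (T (Suc k))"
    by (rule T_step[OF k])
  also have "\<dots> \<le> (\<kappa> / real k * ?e k) * norm s"
  proof (rule mult_mono)
    show "norm (T (Suc k)) \<le> norm s" by (rule norm_T_le[OF s_argmin]) simp
    show "0 \<le> \<kappa> / real k * ?e k"
      using \<kappa>(1) by (intro mult_nonneg_nonneg less_imp_le[OF pos]) simp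
  qed (use \<open>?e k - ?e (Suc k) \<le> _\<close> in auto)
  finally have "?e k * norm (T k - T (Suc k)) \<le> ?e k * (\<kappa> / real k * norm s)"
    by (simp add: mult_ac)
  from mult_left_le_imp_le[OF this pos] show ?thesis by (simp add: norm_minus_commute)
qed

text \<open>Growth of \<open>D\<close> at \<open>y\<close> is charged to the gap by
  \<open>D_gap_le\<close>, and decay of \<open>reg\<close> at \<open>y\<close> helps. In the minimal
  value, evaluated at \<open>T (Suc k)\<close>, only the decay of \<open>reg\<close> hurts.\<close>

lemma gap_drift:
  assumes k: "k \<ge> 1" and growth: "D (Suc k) \<le> (1 + K / real k) * D k"
  shows "gap (Suc k) y \<le> (1 + \<kappa> / real k) * gap k y + \<kappa> / real k * reg k * (norm s)\<^sup>2"
proof -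
  let ?r = "\<kappa> / real k"
  have r: "?r \<ge> 0" using \<kappa> by simp
  have "K / real k \<le> ?r" using \<kappa> by (simp add: divide_right_mono)
  then have "D (Suc k) \<le> (1 + ?r) * D k"
    using growth mult_right_mono[of "K / real k" ?r "D k"] D_pos[of k] by (simp add: algebra_simps)
  then have "(D (Suc k) - D k) * (g y - g s) \<le> (?r * D k) * (g y - g s)"
    using g_ge by (intro mult_right_mono) (auto simp: algebra_simps)
  also have "\<dots> \<le> ?r * (gap k y + reg k / 2 * (norm s)\<^sup>2)"
    using mult_left_mono[OF D_gap_le[OF k, of y] r] by (simp add: mult_ac)
  finally have 1: "(D (Suc k) - D k) * (g y - g s) \<le> ?r * gap k y + ?r * reg k / 2 * (norm s)\<^sup>2"
    by (simp add: algebra_simps)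
  have 2: "(reg (Suc k) - reg k) * (norm y)\<^sup>2 \<le> 0"
    using reg_mono[OF k] by (simp add: mult_le_0_iff)
  have 3: "(D (Suc k) - D k) * (g (T (Suc k)) - g s) \<ge> 0"
    using D_mono g_ge by (simp add: monoD)
  have "(reg k - reg (Suc k)) * (norm (T (Suc k)))\<^sup>2 \<le> (?r * reg k) * (norm s)\<^sup>2"
  proof (rule mult_mono)
    have "reg k - reg (Suc k) = E * (real k powr (- p) - real (Suc k) powr (- p))"
      by (simp add: reg_def algebra_simps)
    also have "\<dots> \<le> E * (p / real k * real k powr (- p))"
      using powr_decrement_le[of p k] p k E by (intro mult_left_mono) auto
    also have "\<dots> \<le> E * (?r * real k powr (- p))"
      using \<kappa> E by (intro mult_left_mono mult_right_mono divide_right_mono) auto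
    finally show "reg k - reg (Suc k) \<le> ?r * reg k" by (simp add: reg_def mult_ac)
    show "(norm (T (Suc k)))\<^sup>2 \<le> (norm s)\<^sup>2"
      by (intro power_mono norm_T_le[OF s_argmin]) auto
    show "0 \<le> ?r * reg k" using r reg_pos[OF k] by (intro mult_nonneg_nonneg) auto
  qed auto
  moreover have "gap k (T (Suc k)) \<ge> 0" by (rule gap_nonneg[OF k])
  ultimately show ?thesis
    using 1 2 3 unfolding gap_def objective_def by (simp add: algebra_simps add_divide_distrib)
qed

text \<open>The entries \<open>A / 12\<close> and \<open>E / (4 * A)\<close> come from the first two
  bounds on \<open>R\<close> in \<open>frozen_step\<close> for
  \<open>R = 2 * rate * real k powr (- s0)\<close>; the entry \<open>1\<close> keeps the contraction
  \<open>r\<close> below at most \<open>1\<close>.\<close>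

definition rate :: real where "rate = min 1 (min (A / 12) (E / (4 * A)))"

lemma rate: "rate > 0" "rate \<le> 1" "12 * rate \<le> A" "4 * A * rate \<le> E"
proof -
  show "rate > 0" "rate \<le> 1" using A E by (auto simp: rate_def)
  have "rate \<le> A / 12" "rate \<le> E / (4 * A)" by (auto simp: rate_def)
  then show "12 * rate \<le> A" "4 * A * rate \<le> E" using A by (auto simp: field_simps)
qed

lemma total_energy_recursion:
  "\<exists>M. eventually (\<lambda>k. total_energy (Suc k) \<le>
     (1 - rate / 2 * real k powr (- s0)) * total_energy k + M * real k powr (- (\<sigma> + s0))) sequentially"
proof -
  define n where "n = (norm s)\<^sup>2"
  define M where "M = B * E\<^sup>2 / (2 * D 0) * n + 15 / 2 * (A / 2)\<^sup>2 * (\<kappa>\<^sup>2 * n) / rate + \<kappa> * E * n"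
  have D_ev: "eventually (\<lambda>k. D k \<ge> 6 * B + B * A) sequentially"
    using D_lim by (simp add: filterlim_at_top)
  \<comment> \<open>Possible because \<open>s0 < 1\<close>. The factor \<open>7\<close> makes the
    quadratic drift term at most \<open>10 / 49 * r\<close>, below \<open>r / 4\<close>.\<close>
  have "eventually (\<lambda>k. 7 * \<kappa> * real k powr (- 1) \<le> rate * real k powr (- s0)) sequentially"
    using s0 rate by (intro eventually_powr_dominates) auto
  moreover have "eventually (\<lambda>k::nat. k \<ge> 1) sequentially" by (rule eventually_ge_at_top)
  ultimately have "eventually (\<lambda>k. total_energy (Suc k) \<le>
     (1 - rate / 2 * real k powr (- s0)) * total_energy k + M * real k powr (- (\<sigma> + s0))) sequentially"
    using D_ev D_growth
  proof eventually_elim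
    case (elim k)
    have k: "k \<ge> 1" and k1: "real k \<ge> 1" and D_k: "D k \<ge> 6 * B + B * A"
      and growth: "D (Suc k) \<le> (1 + K / real k) * D k" using elim by auto
    define r where "r = rate * real k powr (- s0)"
    define w where "w = \<kappa> / real k"
    define e' where "e' = energy (damp k) (gap k (x (Suc k))) (x (Suc k) - T k) (vel (Suc k))"
    define c where "c = 1 + 1 / (r / 4)"
    have powr_le1: "real k powr (- t) \<le> 1" if "t \<ge> 0" for t
      using powr_mono[of "- t" 0 "real k"] k1 that by simp
    have r: "0 < r" "r \<le> 1"
      using rate powr_le1[of s0] s0 k mult_mono[of rate 1 "real k powr (- s0)" 1]
      by (auto simp: r_def)
    have w: "0 \<le> w" "7 * w \<le> r"
      using elim(1) \<kappa> k by (auto simp: w_def r_def powr_minus_divide)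
    have c: "0 \<le> c" "c \<le> 5 / r" using r by (auto simp: c_def field_simps)
    have e'_nn: "0 \<le> e'" using gap_nonneg[OF k] by (simp add: e'_def energy_def)
    have "(1 + 2 * r) * e' \<le> total_energy k + B * (reg k)\<^sup>2 / (2 * D k) * n"
      unfolding e'_def n_def
    proof (rule frozen_step[OF k])
      have "12 * rate * real k powr (- s0) \<le> A * real k powr (- q)"
        using rate s0 k1 by (intro mult_mono powr_mono) auto
      then show "3 * (2 * r) \<le> damp k" by (simp add: r_def damp_def)
      have "(4 * A * rate) * real k powr (- s0 + - q) \<le> E * real k powr (- p)"
        using rate s0 k1 E by (intro mult_mono powr_mono) auto
      then show "4 * (2 * r) * damp k \<le> reg k"
        unfolding powr_add by (simp add: r_def damp_def reg_def mult_ac)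
      have "6 * B * r + B * damp k \<le> 6 * B * 1 + B * A"
      proof (intro add_mono mult_left_mono)
        show "damp k \<le> A" using powr_le1[of q] q A mult_left_mono[of "real k powr - q" 1 "A / 2"]
          by (simp add: damp_def)
      qed (use r B in auto)
      then show "3 * B * (2 * r) + B * damp k \<le> D k" using D_k by simp
    qed (use r in simp)
    moreover have "B * (reg k)\<^sup>2 / (2 * D k) * n \<le> B * E\<^sup>2 / (2 * D 0) * n * real k powr (- (\<sigma> + s0))"
    proof -
      have "(real k powr (- p))\<^sup>2 = real k powr (- p + - p)" by (simp only: power2_eq_square powr_add)
      also have "\<dots> \<le> real k powr (- (\<sigma> + s0))"
        using k1 p by (intro powr_mono) (auto simp: \<sigma>_def)
      finally have sq: "E\<^sup>2 * (real k powr (- p))\<^sup>2 \<le> E\<^sup>2 * real k powr (- (\<sigma> + s0))"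
        by (intro mult_left_mono) auto
      then have "B * (reg k)\<^sup>2 / (2 * D k) \<le> B * (E\<^sup>2 * real k powr (- (\<sigma> + s0))) / (2 * D 0)"
        unfolding reg_def power_mult_distrib using B D_pos[of 0] D_ge[of k]
        by (intro frac_le mult_left_mono[OF sq]) auto
      then have "B * (reg k)\<^sup>2 / (2 * D k) * n \<le> B * (E\<^sup>2 * real k powr (- (\<sigma> + s0))) / (2 * D 0) * n"
        by (rule mult_right_mono) (simp add: n_def)
      then show ?thesis by (simp add: mult_ac)
    qed
    ultimately have e': "(1 + 2 * r) * e' \<le> total_energy k + B * E\<^sup>2 / (2 * D 0) * n * real k powr (- (\<sigma> + s0))"
      by linarith
    have "total_energy (Suc k) \<le> (1 + r / 4 + 2 * (1 + 1 / (r / 4)) * w\<^sup>2) * e'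
        + 3 / 2 * (1 + 1 / (r / 4)) * (damp k)\<^sup>2 * (w * norm s)\<^sup>2 + w * reg k * n"
    proof -
      have "energy (damp (Suc k)) (gap (Suc k) (x (Suc k)))
          ((x (Suc k) - T k) - (T (Suc k) - T k)) (vel (Suc k)) \<le>
          (1 + r / 4 + 2 * (1 + 1 / (r / 4)) * w\<^sup>2) * e'
        + 3 / 2 * (1 + 1 / (r / 4)) * (damp k)\<^sup>2 * (w * norm s)\<^sup>2 + w * reg k * n"
        unfolding e'_def
      proof (rule energy_drift)
        show "norm (T (Suc k) - T k) \<le> w * norm s" unfolding w_def by (rule T_drift[OF k growth])
        show "gap (Suc k) (x (Suc k)) \<le> (1 + w) * gap k (x (Suc k)) + w * reg k * n"
          unfolding w_def n_def by (rule gap_drift[OF k growth])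
        have "damp k - damp (Suc k) = A / 2 * (real k powr (- q) - real (Suc k) powr (- q))"
          by (simp add: damp_def algebra_simps)
        also have "\<dots> \<le> A / 2 * (q / real k * real k powr (- q))"
          using powr_decrement_le[of q k] q k A by (intro mult_left_mono) auto
        also have "\<dots> \<le> A / 2 * (w * real k powr (- q))"
          using \<kappa> A by (intro mult_left_mono mult_right_mono) (auto simp: w_def divide_right_mono)
        finally show "damp k - damp (Suc k) \<le> w * damp k" by (simp add: damp_def mult_ac)
        show "0 \<le> damp (Suc k)" using damp_pos[of "Suc k"] by simp
      qed (use r w damp_mono[OF k] gap_nonneg[OF k] in auto)
      then show ?thesis by (simp add: total_energy_def)
    qed
    also have "\<dots> = (1 + r / 4 + 2 * c * w\<^sup>2) * e' + 3 / 2 * c * (damp k)\<^sup>2 * (w\<^sup>2 * n) + w * reg k * n"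
      by (simp add: c_def n_def power_mult_distrib)
    also have "\<dots> \<le> (1 + r / 2) * e' + 15 / 2 * (A / 2)\<^sup>2 * (\<kappa>\<^sup>2 * n) / rate * real k powr (- (\<sigma> + s0))
        + \<kappa> * E * n * real k powr (- (\<sigma> + s0))"
    proof -
      have "c * w\<^sup>2 \<le> 5 / r * (r / 7)\<^sup>2"
        using c w r by (intro mult_mono power_mono) auto
      then have factor: "1 + r / 4 + 2 * c * w\<^sup>2 \<le> 1 + r / 2"
        using r by (simp add: power2_eq_square field_simps)
      have "c * (real k powr (- q) * real k powr (- q) * (real k powr (- 1) * real k powr (- 1)))
          \<le> 5 / r * (real k powr (- q) * real k powr (- q) * (real k powr (- 1) * real k powr (- 1)))"
        using c by (intro mult_right_mono) auto
      also have "5 / r = 5 / rate * real k powr s0"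
        by (simp add: r_def powr_minus_divide)
      also have "5 / rate * real k powr s0 *
          (real k powr (- q) * real k powr (- q) * (real k powr (- 1) * real k powr (- 1)))
          = 5 / rate * real k powr (s0 + - q + - q + - 1 + - 1)"
        by (simp only: powr_add mult_ac)
      also have "\<dots> \<le> 5 / rate * real k powr (- (\<sigma> + s0))"
        using k1 rate by (intro mult_left_mono powr_mono) (auto simp: \<sigma>_def)
      finally have "3 / 2 * (A / 2)\<^sup>2 * (\<kappa>\<^sup>2 * n) *
          (c * (real k powr (- q) * real k powr (- q) * (real k powr (- 1) * real k powr (- 1))))
          \<le> 3 / 2 * (A / 2)\<^sup>2 * (\<kappa>\<^sup>2 * n) * (5 / rate * real k powr (- (\<sigma> + s0)))"
        by (rule mult_left_mono) (simp add: n_def)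
      then have drift: "3 / 2 * c * (damp k)\<^sup>2 * (w\<^sup>2 * n)
          \<le> 15 / 2 * (A / 2)\<^sup>2 * (\<kappa>\<^sup>2 * n) / rate * real k powr (- (\<sigma> + s0))"
        using k by (simp add: damp_def w_def power_mult_distrib power2_eq_square powr_minus_divide mult_ac)
      have "real k powr (- 1) * real k powr (- p) \<le> real k powr (- (\<sigma> + s0))"
        unfolding powr_add[symmetric] using k1 by (intro powr_mono) (auto simp: \<sigma>_def)
      then have "\<kappa> * E * n * (real k powr (- 1) * real k powr (- p)) \<le> \<kappa> * E * n * real k powr (- (\<sigma> + s0))"
        using \<kappa> E by (intro mult_left_mono) (auto simp: n_def)
      then have value_drift: "w * reg k * n \<le> \<kappa> * E * n * real k powr (- (\<sigma> + s0))"
        using k by (simp add: w_def reg_def powr_minus_divide mult_ac)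
      show ?thesis
        by (intro add_mono mult_right_mono[OF factor e'_nn] drift value_drift)
    qed
    finally have "total_energy (Suc k) \<le> (1 + r / 2) * e'
        + 15 / 2 * (A / 2)\<^sup>2 * (\<kappa>\<^sup>2 * n) / rate * real k powr (- (\<sigma> + s0))
        + \<kappa> * E * n * real k powr (- (\<sigma> + s0))" .
    moreover have "(1 + r / 2) * e' \<le> (1 - r / 2) * total_energy k + B * E\<^sup>2 / (2 * D 0) * n * real k powr (- (\<sigma> + s0))"
    proof -
      define f where "f = B * E\<^sup>2 / (2 * D 0) * n * real k powr (- (\<sigma> + s0))"
      have f: "0 \<le> f" using B D_pos[of 0] by (simp add: n_def f_def)
      \<comment> \<open>For \<open>0 \<le> r \<le> 1\<close> this is the net balance
        \<open>1 + r / 2 \<le> (1 - r / 2) * (1 + 2 * r)\<close>.\<close>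
      have "0 \<le> r * (1 - r) * e'" using r e'_nn by (intro mult_nonneg_nonneg) auto
      then have "(1 + r / 2) * e' \<le> (1 - r / 2) * ((1 + 2 * r) * e')"
        by (simp add: algebra_simps)
      also have "\<dots> \<le> (1 - r / 2) * (total_energy k + f)"
        using e' r unfolding f_def by (intro mult_left_mono) auto
      also have "\<dots> \<le> (1 - r / 2) * total_energy k + f"
        using mult_nonneg_nonneg[of "r / 2" f] f r by (simp add: algebra_simps)
      finally show ?thesis unfolding f_def .
    qed
    moreover have half: "rate / 2 * real k powr (- s0) = r / 2" by (simp add: r_def)
    ultimately show ?case unfolding half M_def distrib_right by linarith
  qed
  then show ?thesis by (rule exI[of _ M])
qed

lemma total_energy_rate:
  "\<exists>C\<ge>0. eventually (\<lambda>k. total_energy k \<le> C * real k powr (- \<sigma>)) sequentially"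
proof -
  obtain M where M: "eventually (\<lambda>k. total_energy (Suc k) \<le>
     (1 - rate / 2 * real k powr (- s0)) * total_energy k + M * real k powr (- (\<sigma> + s0))) sequentially"
    using total_energy_recursion by blast
  show ?thesis
    by (rule discrete_gronwall_powr[OF _ _ _ _ M]) (use rate s0 \<sigma>_pos in auto)
qed

section \<open>Rates read off from the energy bound\<close>

lemma sq_le_powr_imp:
  assumes "y\<^sup>2 \<le> C * real k powr t" "C \<ge> 0"
  shows "y \<le> sqrt C * real k powr (t / 2)"
proof (rule power2_le_imp_le)
  have "(real k powr (t / 2))\<^sup>2 = real k powr (t / 2 + t / 2)"
    by (simp only: power2_eq_square powr_add)
  then show "y\<^sup>2 \<le> (sqrt C * real k powr (t / 2))\<^sup>2"
    using assms by (simp add: power_mult_distrib)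
qed (use assms in simp)

text \<open>The energy controls the squared distance with weight of order
  \<open>k powr (- p)\<close> through the gap and \<open>k powr (- 2 * q)\<close> through its last
  summand. The exponent \<open>q + p - s0\<close> is the smaller of \<open>p\<close> and
  \<open>2 * q\<close>, so the better weight is used.\<close>

lemma distance_rate: "(\<lambda>k. norm (x k - T k)) \<in> O(\<lambda>k. real k powr ((q + p - s0 - \<sigma>) / 2))"
proof -
  obtain C where C: "C \<ge> 0" "eventually (\<lambda>k. total_energy k \<le> C * real k powr (- \<sigma>)) sequentially"
    using total_energy_rate by blast
  define m where "m = q + p - s0"
  define c where "c = min (E / 2) (A\<^sup>2 / 8)"
  have c: "c > 0" using E A by (simp add: c_def)
  have m: "m = p \<or> m = 2 * q" by (auto simp: m_def s0_def max_def)
  show ?thesis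
    unfolding m_def[symmetric]
  proof (rule bigoI)
    show "eventually (\<lambda>k. norm (norm (x k - T k)) \<le> sqrt (C / c) * norm (real k powr ((m - \<sigma>) / 2)))
        sequentially"
      using C(2) eventually_ge_at_top[of "1::nat"]
    proof eventually_elim
      case (elim k)
      let ?n = "(norm (x k - T k))\<^sup>2"
      have "c * real k powr (- m) * ?n \<le> total_energy k"
        using m
      proof
        assume "m = p"
        have "c * real k powr (- m) * ?n \<le> E / 2 * real k powr (- m) * ?n"
          by (intro mult_right_mono) (auto simp: c_def)
        also have "\<dots> = reg k / 2 * ?n" using \<open>m = p\<close> by (simp add: reg_def)
        also have "\<dots> \<le> gap k (x k)" using gap_ge elim by simp
        also have "\<dots> \<le> total_energy k" by (simp add: total_energy_def energy_def)
        finally show ?thesis .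
      next
        assume "m = 2 * q"
        then have "real k powr (- m) = real k powr (- q) * real k powr (- q)"
          by (simp flip: powr_add)
        moreover have "c * real k powr (- m) * ?n \<le> A\<^sup>2 / 8 * real k powr (- m) * ?n"
          by (intro mult_right_mono) (auto simp: c_def)
        ultimately have "c * real k powr (- m) * ?n \<le> (damp k)\<^sup>2 * ?n / 2"
          by (simp add: damp_def power2_eq_square mult_ac)
        also have "\<dots> \<le> total_energy k" using gap_nonneg elim by (simp add: total_energy_def energy_def)
        finally show ?thesis .
      qed
      then have "c * real k powr (- m) * ?n \<le> C * real k powr (- \<sigma>)" using elim by linarith
      then have "real k powr m / c * (c * real k powr (- m) * ?n) \<le> real k powr m / c * (C * real k powr (- \<sigma>))"
        using c by (intro mult_left_mono) auto
      then have "?n \<le> C / c * real k powr (m - \<sigma>)"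
        using c elim by (simp add: powr_diff powr_minus field_simps)
      from sq_le_powr_imp[OF this] show ?case using C c by simp
    qed
  qed
qed

text \<open>Passing from the gap to values costs a multiple of \<open>reg k\<close>, which caps the
  exponent at \<open>p\<close>.\<close>

lemma value_rate: "(\<lambda>k. g (x k) - g s) \<in> O(\<lambda>k. real k powr (- min \<sigma> p) / D k)"
proof -
  obtain C where C: "C \<ge> 0" "eventually (\<lambda>k. total_energy k \<le> C * real k powr (- \<sigma>)) sequentially"
    using total_energy_rate by blast
  define n where "n = E / 2 * (norm s)\<^sup>2"
  have n: "n \<ge> 0" using E by (simp add: n_def)
  show ?thesis
  proof (rule bigoI)
    show "eventually (\<lambda>k. norm (g (x k) - g s) \<le> (C + n) * norm (real k powr (- min \<sigma> p) / D k))
        sequentially"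
      using C(2) eventually_ge_at_top[of "1::nat"]
    proof eventually_elim
      case (elim k)
      let ?t = "real k powr (- min \<sigma> p)"
      have "D k * (g (x k) - g s) \<le> gap k (x k) + reg k / 2 * (norm s)\<^sup>2"
        using elim by (intro D_gap_le) simp
      also have "\<dots> \<le> total_energy k + n * real k powr (- p)"
        by (simp add: total_energy_def energy_def n_def reg_def)
      also have "\<dots> \<le> C * real k powr (- \<sigma>) + n * real k powr (- p)" using elim by simp
      also have "\<dots> \<le> C * ?t + n * ?t"
        using elim C n by (intro add_mono mult_left_mono powr_mono) auto
      finally show ?case using D_pos[of k] g_ge[of "x k"] by (simp add: field_simps)
    qed
  qed
qed

text \<open>In every regime \<open>q < 1\<close> and \<open>p < q + 1\<close> make the exponent of
  the distance negative, so the iterates follow the Tikhonov curve to its limit.\<close>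

lemma x_tendsto: "x \<longlonglongrightarrow> min_norm_element (argmin g)"
proof -
  have "(q + p - s0 - \<sigma>) / 2 < 0"
    using p q by (auto simp: \<sigma>_def s0_def max_def min_def)
  then have "(\<lambda>k. real k powr ((q + p - s0 - \<sigma>) / 2)) \<longlonglongrightarrow> 0"
    by (rule tendsto_neg_powr) (rule filterlim_real_sequentially)
  then have lim: "(\<lambda>k. c * real k powr ((q + p - s0 - \<sigma>) / 2)) \<longlonglongrightarrow> 0" for c
    by (rule tendsto_mult_right_zero)
  obtain c where "eventually (\<lambda>k. norm (norm (x k - T k)) \<le>
      c * norm (real k powr ((q + p - s0 - \<sigma>) / 2))) sequentially"
    using landau_o.bigE[OF distance_rate] by blast
  then have "eventually (\<lambda>k. norm (x k - T k) \<le> c * real k powr ((q + p - s0 - \<sigma>) / 2)) sequentially"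
    by simp
  then have "(\<lambda>k. x k - T k) \<longlonglongrightarrow> 0"
    by (rule Lim_null_comparison) (rule lim)
  from tendsto_add[OF this T_tendsto] show ?thesis by simp
qed

text \<open>\<open>vel k\<close> is the difference of the two vectors whose squared norms occur in
  the energy.\<close>

lemma vel_rate:
  "\<exists>C\<ge>0. eventually (\<lambda>k. norm (vel k) \<le> C * real k powr (- \<sigma> / 2)) sequentially"
proof -
  obtain C where C: "C \<ge> 0" "eventually (\<lambda>k. total_energy k \<le> C * real k powr (- \<sigma>)) sequentially"
    using total_energy_rate by blast
  have "eventually (\<lambda>k. norm (vel k) \<le> 2 * sqrt (2 * C) * real k powr (- \<sigma> / 2)) sequentially"
    using C(2) eventually_ge_at_top[of "1::nat"]
  proof eventually_elim
    case (elim k)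
    let ?z = "damp k *\<^sub>R (x k - T k)"
    have "(norm (?z + vel k))\<^sup>2 \<le> 2 * total_energy k" "(norm ?z)\<^sup>2 \<le> 2 * total_energy k"
      using gap_nonneg elim by (auto simp: total_energy_def energy_def power_mult_distrib)
    then have "(norm (?z + vel k))\<^sup>2 \<le> 2 * C * real k powr (- \<sigma>)" "(norm ?z)\<^sup>2 \<le> 2 * C * real k powr (- \<sigma>)"
      using elim by auto
    then have "norm (?z + vel k) \<le> sqrt (2 * C) * real k powr (- \<sigma> / 2)"
      "norm ?z \<le> sqrt (2 * C) * real k powr (- \<sigma> / 2)"
      using C(1) by (auto dest!: sq_le_powr_imp)
    moreover have "norm (vel k) \<le> norm (?z + vel k) + norm ?z"
      using norm_triangle_ineq4[of "?z + vel k" ?z] by simp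
    ultimately show ?case by simp
  qed
  then show ?thesis using C(1) by (intro exI[of _ "2 * sqrt (2 * C)"]) auto
qed

text \<open>The gradient is recovered from the recursion: solving it for the gradient at the new
  iterate leaves the factor D k - damping, which is of order D k.\<close>

lemma gradient_rate: "(\<lambda>k. norm (gradg (x k))) \<in> O(\<lambda>k. real k powr (- \<sigma> / 2) / D k)"
proof -
  obtain C where C: "C \<ge> 0" "eventually (\<lambda>k. norm (vel k) \<le> C * real k powr (- \<sigma> / 2)) sequentially"
    using vel_rate by blast
  \<comment> \<open>The convergence just proved bounds the iterates, and with them the
    regularisation term.\<close>
  obtain X where X: "X > 0" "\<And>k. norm (x k) \<le> X"
    using convergent_imp_Bseq[OF convergentI[OF x_tendsto]] unfolding Bseq_def by blast
  have D1: "eventually (\<lambda>k. D k \<ge> 2 * A * B) sequentially"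
    using D_lim by (simp add: filterlim_at_top)
  have D2: "eventually (\<lambda>k. K * real k powr (- 1) \<le> 1 * real k powr 0) sequentially"
    by (rule eventually_powr_dominates) auto
  have CS: "eventually (\<lambda>k. norm (vel (Suc k)) \<le> C * real (Suc k) powr (- \<sigma> / 2)) sequentially"
    using C(2) by (subst eventually_sequentially_Suc)
  \<comment> \<open>The power of \<open>2\<close> converts from \<open>k\<close> to
    \<open>Suc k \<le> 2 * k\<close>. The later factor \<open>4\<close> combines
    \<open>D (Suc k) \<le> 2 * D k\<close> with the loss of half of \<open>D k\<close> to the
    damping.\<close>
  define M where "M = (C + (1 + A) * C + E * X) * 2 powr (\<sigma> / 2)"
  have "eventually (\<lambda>k. norm (gradg (x (Suc k))) \<le> 4 * M * (real (Suc k) powr (- \<sigma> / 2) / D (Suc k))) sequentially"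
    using C(2) CS D1 D2 D_growth eventually_ge_at_top[of "1::nat"]
  proof eventually_elim
    case (elim k)
    let ?G = "gradg (x (Suc k))"
    have k: "real k \<ge> 1" using elim by simp
    have damp: "0 \<le> 2 * damp k" "2 * damp k \<le> A"
      using powr_mono[of "- q" 0 "real k"] q A k mult_left_mono[of "real k powr - q" 1 A]
      by (auto simp: damp_def)
    have "2 * damp k * B \<le> A * B" using damp(2) B by (intro mult_right_mono) auto
    then have "D k - 2 * damp k * B \<ge> D k / 2" using elim(3) by linarith
    have "D (Suc k) \<le> 2 * D k"
    proof -
      have "K / real k \<le> 1" using elim k by (simp add: powr_minus_divide)
      then show ?thesis using elim D_pos[of k] mult_right_mono[of "K / real k" 1 "D k"]
        by (simp add: algebra_simps)
    qed
    define V where "V = x (Suc k) - x k"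
    have V: "V = vel (Suc k) - B *\<^sub>R ?G" by (simp add: vel_def V_def)
    have rec: "vel k = vel (Suc k) + (2 * damp k) *\<^sub>R V + (D k *\<^sub>R ?G + reg k *\<^sub>R x (Suc k))"
      using recursion[of k] elim by (simp add: vel_def V_def damp_def reg_def)
    \<comment> \<open>The displacement is eliminated in favour of \<open>vel (Suc k)\<close> and the
      gradient, leaving the gradient as the only unknown.\<close>
    have "(D k - 2 * damp k * B) *\<^sub>R ?G = vel k - (1 + 2 * damp k) *\<^sub>R vel (Suc k) - reg k *\<^sub>R x (Suc k)"
      unfolding rec V by (simp add: algebra_simps)
    then have "\<bar>D k - 2 * damp k * B\<bar> * norm ?G
        = norm (vel k - (1 + 2 * damp k) *\<^sub>R vel (Suc k) - reg k *\<^sub>R x (Suc k))"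
      by (metis norm_scaleR)
    also have "\<dots> \<le> norm (vel k) + norm ((1 + 2 * damp k) *\<^sub>R vel (Suc k)) + norm (reg k *\<^sub>R x (Suc k))"
      by (intro order_trans[OF norm_triangle_ineq4] add_mono order_refl norm_triangle_ineq4)
    also have "\<dots> \<le> C * real k powr (- \<sigma> / 2) + (1 + A) * (C * real k powr (- \<sigma> / 2))
        + (E * real k powr (- \<sigma> / 2)) * X"
    proof (intro add_mono)
      have "real (Suc k) powr (- \<sigma> / 2) \<le> real k powr (- \<sigma> / 2)"
        using \<sigma>_pos k by (intro powr_mono2') auto
      then have "norm (vel (Suc k)) \<le> C * real k powr (- \<sigma> / 2)"
        using elim(2) C(1) mult_left_mono by (meson order_trans)
      then have "(1 + 2 * damp k) * norm (vel (Suc k)) \<le> (1 + A) * (C * real k powr (- \<sigma> / 2))"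
        using damp A by (intro mult_mono) auto
      then show "norm ((1 + 2 * damp k) *\<^sub>R vel (Suc k)) \<le> (1 + A) * (C * real k powr (- \<sigma> / 2))"
        using damp by simp
      have "- p \<le> - \<sigma> / 2" using s0 p q by (auto simp: \<sigma>_def)
      then have "reg k \<le> E * real k powr (- \<sigma> / 2)"
        unfolding reg_def using k E by (intro mult_left_mono powr_mono) auto
      then have "reg k * norm (x (Suc k)) \<le> (E * real k powr (- \<sigma> / 2)) * X"
        using X E by (intro mult_mono) auto
      then show "norm (reg k *\<^sub>R x (Suc k)) \<le> (E * real k powr (- \<sigma> / 2)) * X"
        using E by (simp add: reg_def)
    qed (use elim in simp)
    also have "\<dots> = (C + (1 + A) * C + E * X) * real k powr (- \<sigma> / 2)" by (simp add: algebra_simps)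
    also have "\<dots> \<le> M * real (Suc k) powr (- \<sigma> / 2)"
    proof -
      have "real k powr (- \<sigma> / 2) = 2 powr (\<sigma> / 2) * (2 * real k) powr (- \<sigma> / 2)"
        by (simp add: powr_mult powr_minus)
      also have "\<dots> \<le> 2 powr (\<sigma> / 2) * real (Suc k) powr (- \<sigma> / 2)"
        using k \<sigma>_pos by (intro mult_left_mono powr_mono2') auto
      finally have "(C + (1 + A) * C + E * X) * real k powr (- \<sigma> / 2)
          \<le> (C + (1 + A) * C + E * X) * (2 powr (\<sigma> / 2) * real (Suc k) powr (- \<sigma> / 2))"
        using C A E X by (intro mult_left_mono) auto
      then show ?thesis by (simp add: M_def mult_ac)
    qed
    finally have 1: "\<bar>D k - 2 * damp k * B\<bar> * norm ?G \<le> M * real (Suc k) powr (- \<sigma> / 2)" .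
    have "D (Suc k) / 4 \<le> \<bar>D k - 2 * damp k * B\<bar>"
      using \<open>D k - 2 * damp k * B \<ge> D k / 2\<close> \<open>D (Suc k) \<le> 2 * D k\<close>
        abs_ge_self[of "D k - 2 * damp k * B"] by linarith
    then have "D (Suc k) / 4 * norm ?G \<le> \<bar>D k - 2 * damp k * B\<bar> * norm ?G"
      by (intro mult_right_mono) auto
    with 1 have "D (Suc k) / 4 * norm ?G \<le> M * real (Suc k) powr (- \<sigma> / 2)" by linarith
    then show ?case using D_pos[of "Suc k"] by (simp add: field_simps)
  qed
  then have "eventually (\<lambda>k. norm (gradg (x k)) \<le> 4 * M * (real k powr (- \<sigma> / 2) / D k)) sequentially"
    by (subst (asm) eventually_sequentially_Suc)
  then show ?thesis using D_pos by (intro bigoI[of _ "4 * M"]) (simp add: less_imp_le)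
qed

lemma velocity_rate: "(\<lambda>k. norm (x k - x (k - 1))) \<in> O(\<lambda>k. real k powr (- \<sigma> / 2))"
proof -
  obtain C where C: "C \<ge> 0" "eventually (\<lambda>k. norm (vel k) \<le> C * real k powr (- \<sigma> / 2)) sequentially"
    using vel_rate by blast
  obtain M where M: "M > 0"
    "eventually (\<lambda>k. norm (norm (gradg (x k))) \<le> M * norm (real k powr (- \<sigma> / 2) / D k)) sequentially"
    using landau_o.bigE[OF gradient_rate] by blast
  show ?thesis
  proof (rule bigoI)
    show "eventually (\<lambda>k. norm (norm (x k - x (k - 1))) \<le> (C + B * M / D 0) * norm (real k powr (- \<sigma> / 2)))
        sequentially"
      using C(2) M(2)
    proof eventually_elim
      case (elim k)
      let ?t = "real k powr (- \<sigma> / 2)"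
      have "norm (gradg (x k)) \<le> M * (?t / D k)" using elim D_pos[of k] by simp
      also have "\<dots> \<le> M * (?t / D 0)"
        using M(1) D_ge[of k] D_pos by (intro mult_left_mono divide_left_mono) auto
      finally have "B * norm (gradg (x k)) \<le> B * (M * (?t / D 0))"
        using B by (intro mult_left_mono) auto
      moreover have "norm (x k - x (k - 1)) \<le> norm (vel k) + B * norm (gradg (x k))"
        using norm_triangle_ineq4[of "vel k" "B *\<^sub>R gradg (x k)"] B by (simp add: vel_def)
      ultimately show ?case using elim by (simp add: algebra_simps)
    qed
  qed
qed

end

section \<open>The proximal algorithm\<close>

text \<open>Dividing numerator and denominator by \<open>(real k * h) powr (q + p)\<close> shows
  \<open>1 / d\<close> to be one plus damping plus regularisation, the form in which the iteration
  becomes an inertial system.\<close>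

lemma ipga_d_inverse:
  assumes "k \<ge> 1" "h > 0" "\<alpha> > 0" "a > 0"
  shows "ipga_d \<alpha> a h q p k > 0"
    and "ipga_d \<alpha> a h q p k * (1 + \<alpha> * h * (real k * h) powr (- q) + h\<^sup>2 * ipga_a a h p k) = 1"
proof -
  define X Y where "X = (real k * h) powr q" and "Y = (real k * h) powr p"
  have XY: "X > 0" "Y > 0" using assms by (auto simp: X_def Y_def)
  have d: "ipga_d \<alpha> a h q p k = X * Y / (X * Y + \<alpha> * h * Y + a * h\<^sup>2 * X)"
    by (simp add: ipga_d_def X_def Y_def powr_add)
  have den: "X * Y + \<alpha> * h * Y + a * h\<^sup>2 * X > 0" using XY assms by (intro add_pos_pos) auto
  show "ipga_d \<alpha> a h q p k > 0" unfolding d using XY den by simp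
  have "1 + \<alpha> * h * (real k * h) powr (- q) + h\<^sup>2 * ipga_a a h p k
      = (X * Y + \<alpha> * h * Y + a * h\<^sup>2 * X) / (X * Y)"
    unfolding ipga_a_def powr_minus X_def[symmetric] Y_def[symmetric]
    using XY by (simp add: field_simps)
  then show "ipga_d \<alpha> a h q p k * (1 + \<alpha> * h * (real k * h) powr (- q) + h\<^sup>2 * ipga_a a h p k) = 1"
    unfolding d using XY den by simp
qed

lemma ipga_recursion:
  fixes g :: "'a::{real_inner, complete_space} \<Rightarrow> real"
  assumes "convex_on UNIV g" "\<And>z. GDERIV g z :> gradg z" "\<And>z. m \<le> g z"
    and pos: "\<alpha> > 0" "a > 0" "\<beta> > 0" "h > 0" "\<delta> k > 0"
    and ipga: "ipga_sequence \<alpha> a \<beta> h q p \<delta> g gradg x" and k: "k \<ge> 1"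
  shows "x k - x (k - 1) + (\<beta> * h) *\<^sub>R gradg (x k) =
      x (Suc k) - x k + (\<beta> * h) *\<^sub>R gradg (x (Suc k))
      + (\<alpha> * h * (real k * h) powr (- q)) *\<^sub>R (x (Suc k) - x k)
      + ((h\<^sup>2 * \<delta> k) *\<^sub>R gradg (x (Suc k)) + (h\<^sup>2 * ipga_a a h p k) *\<^sub>R x (Suc k))"
proof -
  define d where "d = ipga_d \<alpha> a h q p k"
  define r where "r = \<beta> * h + h\<^sup>2 * \<delta> k"
  define c where "c = \<alpha> * h * (real k * h) powr (- q)"
  define b where "b = h\<^sup>2 * ipga_a a h p k"
  define u where "u = x k - x (k - 1) + (\<beta> * h) *\<^sub>R gradg (x k)"
  define V where "V = x (Suc k) - x k"
  define G where "G = gradg (x (Suc k))"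
  have d: "d > 0" "d * (1 + c + b) = 1"
    unfolding d_def c_def b_def using ipga_d_inverse[OF k pos(4,1,2)] by auto
  have r: "r > 0" unfolding r_def using pos by (intro add_pos_pos) auto
  have "x (Suc k) = prox (d * r) g (x k + d *\<^sub>R u - (d * b) *\<^sub>R x k)"
    using ipga k by (simp add: ipga_sequence_def ipga_rho_def ipga_y_def d_def r_def b_def u_def mult_ac)
  then have "x (Suc k) + (d * r) *\<^sub>R G = x k + d *\<^sub>R u - (d * b) *\<^sub>R x k"
    unfolding G_def using prox_resolvent[OF assms(1,2,3), of "d * r"] d r by simp
  \<comment> \<open>The coefficient \<open>1\<close> of the displacement is replaced by
    \<open>d * (1 + c + b)\<close>, so that \<open>d\<close> can be cancelled.\<close>
  then have "(d * (1 + c + b)) *\<^sub>R V + (d * r) *\<^sub>R G = d *\<^sub>R u - (d * b) *\<^sub>R x k"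
    unfolding d V_def by (simp add: algebra_simps)
  then have "d *\<^sub>R u = d *\<^sub>R ((1 + c + b) *\<^sub>R V + r *\<^sub>R G + b *\<^sub>R x k)"
    by (simp add: scaleR_add_right algebra_simps)
  then have "u = (1 + c + b) *\<^sub>R V + r *\<^sub>R G + b *\<^sub>R x k"
    using d by simp
  \<comment> \<open>Here \<open>b\<close> times \<open>V\<close> and \<open>b\<close> times
    \<open>x k\<close> merge into the regularisation at \<open>x (Suc k)\<close>: the explicit
    Tikhonov term has become implicit.\<close>
  also have "\<dots> = V + (\<beta> * h) *\<^sub>R G + c *\<^sub>R V + ((h\<^sup>2 * \<delta> k) *\<^sub>R G + b *\<^sub>R x (Suc k))"
    by (simp add: r_def V_def algebra_simps)
  finally show ?thesis by (simp only: u_def V_def G_def c_def b_def)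
qed

text \<open>Since \<open>(1 + 1 / k) powr p \<le> 1 + 3 / k\<close> for \<open>p \<le> 2\<close>,
  the denominator is at least \<open>1 - 3 * c / k\<close> times \<open>real k powr p\<close>, and
  \<open>1 / (1 - y) \<le> 1 + 2 * y\<close> for \<open>0 \<le> y \<le> 1 / 2\<close>.\<close>

lemma growth_condition_linear:
  fixes \<delta> :: "nat \<Rightarrow> real"
  assumes \<delta>: "\<And>k. \<delta> k > 0" and p: "p \<le> 2" and c: "c > 0"
    and growth: "\<And>k. k \<ge> 1 \<Longrightarrow> \<delta> (k + 1) \<le>
      real k powr p / ((1 + c) * real k powr p - c * real (k + 1) powr p) * \<delta> k"
  shows "eventually (\<lambda>k. \<delta> (Suc k) \<le> (1 + 6 * c / real k) * \<delta> k) sequentially"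
proof -
  have "eventually (\<lambda>k. 6 * c \<le> real k \<and> 1 \<le> k) sequentially"
    using filterlim_real_sequentially by (auto simp: filterlim_at_top intro!: eventually_conj eventually_ge_at_top)
  then show ?thesis
  proof eventually_elim
    case (elim k)
    have k: "k \<ge> 1" and k1: "real k \<ge> 1" using elim by auto
    define y where "y = 3 * c / real k"
    define N where "N = (1 + c) * real k powr p - c * real (k + 1) powr p"
    have y: "0 < y" "y \<le> 1 / 2" using c elim k1 by (auto simp: y_def field_simps)
    \<comment> \<open>Positivity of the denominator is forced: the growth bound lies above
      \<open>\<delta> (k + 1) > 0\<close>, and division by zero would give \<open>0\<close>.\<close>
    have "real k powr p / N * \<delta> k > 0"
      using growth[OF k] \<delta>[of "k + 1"] unfolding N_def by linarith
    then have "real k powr p / N > 0" using \<delta>[of k] by (rule zero_less_mult_pos2)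
    then have N: "N > 0" by (simp add: zero_less_divide_iff)
    have *: "\<delta> (k + 1) * N \<le> real k powr p * \<delta> k"
      using growth[OF k] N unfolding N_def[symmetric] by (simp add: field_simps)
    have "real (k + 1) = real k * (1 + 1 / real k)" using k1 by (simp add: field_simps)
    then have "real (k + 1) powr p = real k powr p * (1 + 1 / real k) powr p"
      by (simp only: powr_mult)
    also have "(1 + 1 / real k) powr p \<le> (1 + 1 / real k) powr 2" using p by (intro powr_mono) auto
    also have "\<dots> = 1 + 2 / real k + (1 / real k) * (1 / real k)"
      by (simp add: powr_numeral power2_eq_square algebra_simps)
    also have "\<dots> \<le> 1 + 2 / real k + (1 / real k) * 1"
      using k1 by (intro add_mono mult_left_mono) auto
    also have "\<dots> = 1 + 3 / real k" by (simp add: field_simps)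
    finally have "real (k + 1) powr p \<le> real k powr p * (1 + 3 / real k)"
      by (simp add: mult_left_mono)
    then have "c * real (k + 1) powr p \<le> c * (real k powr p * (1 + 3 / real k))"
      using c by (intro mult_left_mono) auto
    then have "real k powr p * (1 - y) \<le> N" by (simp add: N_def y_def algebra_simps)
    then have "\<delta> (k + 1) * (real k powr p * (1 - y)) \<le> \<delta> (k + 1) * N"
      using \<delta>[of "k + 1"] by (intro mult_left_mono) auto
    with * have "real k powr p * (\<delta> (k + 1) * (1 - y)) \<le> real k powr p * \<delta> k"
      by (simp add: mult_ac)
    then have "\<delta> (k + 1) * (1 - y) \<le> \<delta> k" using k by (simp add: mult_le_cancel_left_pos)
    then have "(1 + 2 * y) * (\<delta> (k + 1) * (1 - y)) \<le> (1 + 2 * y) * \<delta> k"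
      using y by (intro mult_left_mono) auto
    moreover have "\<delta> (k + 1) * (y * (1 - 2 * y)) \<ge> 0" using \<delta>[of "k + 1"] y by simp
    ultimately have "\<delta> (k + 1) \<le> (1 + 2 * y) * \<delta> k" by (simp add: algebra_simps)
    then show ?case by (simp add: y_def)
  qed
qed

section \<open>Landau form of the rates and assembly of the theorem\<close>

lemma bigo_powr_neg:
  assumes "f \<in> O(\<lambda>k. real k powr (- t))"
  shows "f \<in> O(\<lambda>k. 1 / real k powr t)"
  using assms by (simp add: powr_minus_divide)

lemma bigo_powr_neg_divide:
  assumes "f \<in> O(\<lambda>k. real k powr (- t) / (c * \<delta> k))"
  shows "f \<in> O(\<lambda>k. 1 / (real k powr t * \<delta> k))"
proof -
  have "(\<lambda>k. real k powr (- t) / (c * \<delta> k)) \<in> O(\<lambda>k. 1 / (real k powr t * \<delta> k))"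
    by (rule bigoI[of _ "1 / \<bar>c\<bar>"]) (simp add: powr_minus_divide abs_mult mult_ac)
  with assms(1) show ?thesis by (rule landau_o.big_trans)
qed

theorem theorem4p2:
  fixes g :: "'a::{real_inner, complete_space} \<Rightarrow> real"
    and gradg :: "'a \<Rightarrow> 'a"
    and \<alpha> a \<beta> h q p :: real
    and \<delta> :: "nat \<Rightarrow> real"
    and x xbar :: "nat \<Rightarrow> 'a"
    and xstar :: 'a
  assumes g_convex: "convex_on UNIV g"
    and g_gradient: "\<And>z. GDERIV g z :> gradg z"
    and g_argmin: "argmin g \<noteq> {}"
    and params_pos: "\<alpha> > 0" "a > 0" "\<beta> > 0" "h > 0"
    and q_range: "0 < q" "q < 1"
    and p_range: "1 < p" "p < q + 1"
    and \<delta>_pos: "\<And>k. \<delta> k > 0"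
    and \<delta>_mono: "mono \<delta>"
    and \<delta>_lim: "filterlim \<delta> at_top sequentially"
    and \<delta>_growth: "\<exists>c>0. \<forall>k\<ge>1. \<delta> (k + 1) \<le>
          real k powr p / ((1 + c) * real k powr p - c * real (k + 1) powr p) * \<delta> k"
    and \<delta>_lower: "\<exists>c0>0. \<forall>k\<ge>1. (\<delta> k)\<^sup>2 \<ge> c0 * real k powr (p - q)"
    and x_ipga: "ipga_sequence \<alpha> a \<beta> h q p \<delta> g gradg x"
  defines "xbar \<equiv> tikhonov_point a h p \<delta> g"
    and "xstar \<equiv> min_norm_element (argmin g)"
  shows "x \<longlonglongrightarrow> xstar
    \<and> (1 < p \<and> p < 2 * q \<longrightarrow>
          (\<lambda>k. g (x k) - g xstar) \<in> O(\<lambda>k. 1 / (real k powr p * \<delta> k))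
        \<and> (\<lambda>k. norm (x k - xbar k)) \<in> O(\<lambda>k. 1 / real k powr ((1 - q) / 2))
        \<and> (\<lambda>k. norm (gradg (x k))) \<in> O(\<lambda>k. 1 / (real k powr ((p - q + 1) / 2) * \<delta> k))
        \<and> (\<lambda>k. norm (x k - x (k - 1))) \<in> O(\<lambda>k. 1 / real k powr ((p - q + 1) / 2)))
    \<and> (2 * q \<le> p \<and> p < 1 / 2 * (3 * q + 1) \<longrightarrow>
          (\<lambda>k. g (x k) - g xstar) \<in> O(\<lambda>k. 1 / (real k powr p * \<delta> k))
        \<and> (\<lambda>k. norm (x k - xbar k)) \<in> O(\<lambda>k. 1 / real k powr ((1 - q) / 2))
        \<and> (\<lambda>k. norm (gradg (x k))) \<in> O(\<lambda>k. 1 / (real k powr ((q + 1) / 2) * \<delta> k))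
        \<and> (\<lambda>k. norm (x k - x (k - 1))) \<in> O(\<lambda>k. 1 / real k powr ((q + 1) / 2)))
    \<and> (1 / 2 * (3 * q + 1) \<le> p \<and> p < q + 1 \<longrightarrow>
          (\<lambda>k. norm (x k - xbar k)) \<in> O(\<lambda>k. 1 / real k powr (q - p + 1))
        \<and> (\<lambda>k. norm (gradg (x k))) \<in> O(\<lambda>k. 1 / (real k powr (2 * q - p + 1) * \<delta> k))
        \<and> (\<lambda>k. norm (x k - x (k - 1))) \<in> O(\<lambda>k. 1 / real k powr (2 * q - p + 1)))
    \<and> (1 / 2 * (3 * q + 1) \<le> p \<and> p < 1 / 3 * (4 * q + 2) \<longrightarrow>
          (\<lambda>k. g (x k) - g xstar) \<in> O(\<lambda>k. 1 / (real k powr p * \<delta> k)))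
    \<and> (1 / 3 * (4 * q + 2) \<le> p \<and> p < q + 1 \<longrightarrow>
          (\<lambda>k. g (x k) - g xstar) \<in> O(\<lambda>k. 1 / (real k powr (4 * q - 2 * p + 2) * \<delta> k)))"
proof -
  obtain w where "w \<in> argmin g" using g_argmin by blast
  then have bdd: "g w \<le> g z" for z by (auto simp: argmin_def is_arg_min_linorder)
  define D where "D k = h\<^sup>2 * \<delta> k" for k
  define E where "E = a * h\<^sup>2 * h powr (- p)"
  define A where "A = \<alpha> * h * h powr (- q)"
  define \<epsilon> where "\<epsilon> k = E * real k powr (- p) / D k" for k
  have E: "E > 0" and A: "A > 0" using params_pos by (auto simp: E_def A_def)
  have D: "D k > 0" for k using params_pos \<delta>_pos by (simp add: D_def)
  have D_mono: "mono D" using \<delta>_mono by (auto simp: D_def mono_def intro!: mult_left_mono)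
  have D_lim: "filterlim D at_top sequentially"
    unfolding D_def using params_pos
    by (intro filterlim_tendsto_pos_mult_at_top[OF tendsto_const _ \<delta>_lim]) auto
  have reg: "h\<^sup>2 * ipga_a a h p k = E * real k powr (- p)" for k
    by (simp add: ipga_a_def E_def powr_mult)
  have damp: "\<alpha> * h * (real k * h) powr (- q) = A * real k powr (- q)" for k
    by (simp add: A_def powr_mult)
  have \<epsilon>: "ipga_a a h p k / \<delta> k = \<epsilon> k" for k
    using params_pos by (simp add: \<epsilon>_def D_def flip: reg)
  have \<epsilon>_pos: "\<epsilon> k > 0" if "k \<ge> 1" for k using that E D by (simp add: \<epsilon>_def)
  have "\<epsilon> \<longlonglongrightarrow> 0"
  proof -
    have "(\<lambda>k. E * real k powr (- p)) \<longlonglongrightarrow> E * 0"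
      using p_range by (intro tendsto_mult tendsto_const tendsto_neg_powr filterlim_real_sequentially) simp
    from tendsto_mult[OF this tendsto_inverse_0_at_top[OF D_lim]] show ?thesis
      by (simp add: \<epsilon>_def[abs_def] divide_inverse)
  qed
  have tik: "tikhonov_curve g gradg xbar \<epsilon>"
  proof
    fix k :: nat assume k: "k \<ge> 1"
    show "gradg (xbar k) + \<epsilon> k *\<^sub>R xbar k = 0"
      unfolding xbar_def \<epsilon>[symmetric]
      by (rule tikhonov_point_stationary[OF g_convex g_gradient bdd]) (use \<epsilon> \<epsilon>_pos[OF k] in simp)
    show "\<epsilon> (Suc k) \<le> \<epsilon> k"
      unfolding \<epsilon>_def using k E D[of k] D_mono p_range
      by (intro frac_le mult_left_mono powr_mono2') (auto simp: monoD)
  qed (use g_convex g_gradient g_argmin \<epsilon>_pos \<open>\<epsilon> \<longlonglongrightarrow> 0\<close> in auto)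
  then have xstar: "xstar \<in> argmin g" unfolding xstar_def by (rule tikhonov_curve.min_norm_element_argmin)
  obtain c where c: "c > 0" "\<And>k. k \<ge> 1 \<Longrightarrow> \<delta> (k + 1) \<le>
      real k powr p / ((1 + c) * real k powr p - c * real (k + 1) powr p) * \<delta> k"
    using \<delta>_growth by blast
  have "eventually (\<lambda>k. \<delta> (Suc k) \<le> (1 + 6 * c / real k) * \<delta> k) sequentially"
    by (rule growth_condition_linear[OF \<delta>_pos _ c]) (use p_range q_range in auto)
  then have growth: "eventually (\<lambda>k. D (Suc k) \<le> (1 + 6 * c / real k) * D k) sequentially"
  proof eventually_elim
    case (elim k)
    then have "h\<^sup>2 * \<delta> (Suc k) \<le> h\<^sup>2 * ((1 + 6 * c / real k) * \<delta> k)" by (intro mult_left_mono) auto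
    then show ?case by (simp add: D_def mult_ac)
  qed
  \<comment> \<open>The reference minimiser is the minimal norm element, so the value estimates
    refer to \<open>xstar\<close> directly.\<close>
  interpret inertial_tikhonov g gradg xbar E p D x A "\<beta> * h" q "6 * c" xstar
  proof (intro inertial_tikhonov.intro inertial_tikhonov_axioms.intro)
    show "tikhonov_curve g gradg xbar (\<lambda>k. E * real k powr - p / D k)"
      using tik by (simp add: \<epsilon>_def[abs_def])
    show "x k - x (k - 1) + (\<beta> * h) *\<^sub>R gradg (x k) =
      x (Suc k) - x k + (\<beta> * h) *\<^sub>R gradg (x (Suc k)) + (A * real k powr (- q)) *\<^sub>R (x (Suc k) - x k)
      + (D k *\<^sub>R gradg (x (Suc k)) + (E * real k powr (- p)) *\<^sub>R x (Suc k))" if "k \<ge> 1" for k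
      using ipga_recursion[OF g_convex g_gradient bdd params_pos \<delta>_pos x_ipga that]
      unfolding reg damp D_def .
  qed (use A E D D_mono D_lim growth c xstar params_pos p_range q_range in auto)
  have objective_rate: "(\<lambda>k. g (x k) - g xstar) \<in> O(\<lambda>k. 1 / (real k powr t * \<delta> k))" if "min \<sigma> p = t" for t
    using value_rate that by (intro bigo_powr_neg_divide[where c = "h\<^sup>2"]) (simp add: D_def)
  have distance: "(\<lambda>k. norm (x k - xbar k)) \<in> O(\<lambda>k. 1 / real k powr t)"
    if "(q + p - s0 - \<sigma>) / 2 = - t" for t
    using distance_rate that by (intro bigo_powr_neg) simp
  have gradient: "(\<lambda>k. norm (gradg (x k))) \<in> O(\<lambda>k. 1 / (real k powr t * \<delta> k))"
    if "- \<sigma> / 2 = - t" for t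
    using gradient_rate unfolding that D_def by (rule bigo_powr_neg_divide)
  have velocity: "(\<lambda>k. norm (x k - x (k - 1))) \<in> O(\<lambda>k. 1 / real k powr t)"
    if "- \<sigma> / 2 = - t" for t
    using velocity_rate unfolding that by (rule bigo_powr_neg)
  \<comment> \<open>The regimes change where \<open>q = p - q\<close> in \<open>s0\<close> and where
    \<open>q + 1 = 4 * q - 2 * p + 2\<close> in \<open>\<sigma>\<close>.\<close>
  have case1: "s0 = q \<and> \<sigma> = p + 1 - q" if "p < 2 * q"
    using that p_range by (auto simp: s0_def \<sigma>_def)
  have case2: "s0 = p - q \<and> \<sigma> = q + 1" if "2 * q \<le> p" "p < 1 / 2 * (3 * q + 1)"
    using that p_range by (auto simp: s0_def \<sigma>_def)
  \<comment> \<open>Here \<open>q < 1\<close> gives \<open>2 * q \<le> p\<close>, which selects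
    \<open>p - q\<close> in \<open>s0\<close>.\<close>
  have case3: "s0 = p - q \<and> \<sigma> = 4 * q - 2 * p + 2" if "1 / 2 * (3 * q + 1) \<le> p"
    using that p_range q_range by (auto simp: s0_def \<sigma>_def)
  show ?thesis
  proof (intro conjI impI; (elim conjE)?)
    show "x \<longlonglongrightarrow> xstar" unfolding xstar_def by (rule x_tendsto)
  next
    assume "p < 2 * q"
    note * = case1[OF this]
    show "(\<lambda>k. g (x k) - g xstar) \<in> O(\<lambda>k. 1 / (real k powr p * \<delta> k))"
      by (rule objective_rate) (use * q_range in auto)
    show "(\<lambda>k. norm (x k - xbar k)) \<in> O(\<lambda>k. 1 / real k powr ((1 - q) / 2))"
      by (rule distance) (use * in \<open>simp add: field_simps\<close>)
    show "(\<lambda>k. norm (gradg (x k))) \<in> O(\<lambda>k. 1 / (real k powr ((p - q + 1) / 2) * \<delta> k))"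
      by (rule gradient) (use * in \<open>simp add: field_simps\<close>)
    show "(\<lambda>k. norm (x k - x (k - 1))) \<in> O(\<lambda>k. 1 / real k powr ((p - q + 1) / 2))"
      by (rule velocity) (use * in \<open>simp add: field_simps\<close>)
  next
    assume "2 * q \<le> p" "p < 1 / 2 * (3 * q + 1)"
    note * = case2[OF this]
    show "(\<lambda>k. g (x k) - g xstar) \<in> O(\<lambda>k. 1 / (real k powr p * \<delta> k))"
      by (rule objective_rate) (use * p_range in auto)
    show "(\<lambda>k. norm (x k - xbar k)) \<in> O(\<lambda>k. 1 / real k powr ((1 - q) / 2))"
      by (rule distance) (use * in \<open>simp add: field_simps\<close>)
    show "(\<lambda>k. norm (gradg (x k))) \<in> O(\<lambda>k. 1 / (real k powr ((q + 1) / 2) * \<delta> k))"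
      by (rule gradient) (use * in \<open>simp add: field_simps\<close>)
    show "(\<lambda>k. norm (x k - x (k - 1))) \<in> O(\<lambda>k. 1 / real k powr ((q + 1) / 2))"
      by (rule velocity) (use * in \<open>simp add: field_simps\<close>)
  next
    assume "1 / 2 * (3 * q + 1) \<le> p"
    note * = case3[OF this]
    show "(\<lambda>k. norm (x k - xbar k)) \<in> O(\<lambda>k. 1 / real k powr (q - p + 1))"
      by (rule distance) (use * in \<open>simp add: field_simps\<close>)
    show "(\<lambda>k. norm (gradg (x k))) \<in> O(\<lambda>k. 1 / (real k powr (2 * q - p + 1) * \<delta> k))"
      by (rule gradient) (use * in \<open>simp add: field_simps\<close>)
    show "(\<lambda>k. norm (x k - x (k - 1))) \<in> O(\<lambda>k. 1 / real k powr (2 * q - p + 1))"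
      by (rule velocity) (use * in \<open>simp add: field_simps\<close>)
    \<comment> \<open>The threshold is where \<open>4 * q - 2 * p + 2\<close> equals
      \<open>p\<close>: below it the cap \<open>p\<close> determines the value rate, above it
      \<open>\<sigma>\<close> does.\<close>
    show "(\<lambda>k. g (x k) - g xstar) \<in> O(\<lambda>k. 1 / (real k powr p * \<delta> k))"
      if "p < 1 / 3 * (4 * q + 2)"
      by (rule objective_rate) (use * that in auto)
  next
    assume large: "1 / 3 * (4 * q + 2) \<le> p"
    then have "1 / 2 * (3 * q + 1) \<le> p" using q_range by simp
    note * = case3[OF this]
    show "(\<lambda>k. g (x k) - g xstar) \<in> O(\<lambda>k. 1 / (real k powr (4 * q - 2 * p + 2) * \<delta> k))"
      by (rule objective_rate) (use * large in auto)
  qed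
qed

end
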